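(* Consider the finite sum case $f(x)=\frac1n\sum_{i=1}^n f_i(x)$, $f_i(x)=\frac1m\sum_{j=1}^m f_{ij}(x)$, $x\in\mathbb{R}^d$. Assume there exists $f_*\in\mathbb{R}$ with $f(x)\ge f_*$ for all $x\in\mathbb{R}^d$; that $f_i$ is $L_i$-smooth for all $i\in\{1,\dots,n\}$, i.e. $\|\nabla f_i(x)-\nabla f_i(y)\|\le L_i\|x-y\|$ for all $x,y\in\mathbb{R}^d$; and that the average $\mathcal{L}$-smoothness assumption (see context) holds with constants $\mathcal{L}_i\ge0$. Put $L^2=\frac1n\sum_{i=1}^nL_i^2$, $\mathcal{L}^2=\frac1n\sum_{i=1}^n\mathcal{L}_i^2$ and $\Delta_0=f(x^0)-f_*$. Let $\mathcal{Q}$ be a quantization operator with parameter $\omega$ and expected density $\zeta_{\mathcal Q}$, and let $p=\min\left\{\frac{\zeta_{\mathcal Q}}{d},\frac{b'}{m+b'}\right\}$, where $b'\le m$. If $$\gamma\le\frac{1}{L+\sqrt{\frac{\max\{d/\zeta_{\mathcal Q}-1,\,m/b'\}}{n}\left(\omega L^2+\frac{(1+\omega)\mathcal{L}^2}{b'}\right)}},$$ then VR-MARINA (finite sum case) requires $$\mathcal{O}\left(\frac{\Delta_0}{\varepsilon^2}\left(L\left(1+\sqrt{\frac{\omega\max\{d/\zeta_{\mathcal Q}-1,\,m/b'\}}{n}}\right)+\mathcal{L}\sqrt{\frac{(1+\omega)\max\{d/\zeta_{\mathcal Q}-1,\,m/b'\}}{nb'}}\right)\right)$$ iterations/communication rounds,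 $$\mathcal{O}\left(m+\frac{\Delta_0}{\varepsilon^2}\left(L\left(b'+\sqrt{\frac{\omega\max\{(d/\zeta_{\mathcal Q}-1)(b')^2,\,mb'\}}{n}}\right)+\mathcal{L}\sqrt{\frac{(1+\omega)\max\{(d/\zeta_{\mathcal Q}-1)b',\,m\}}{n}}\right)\right)$$ stochastic oracle calls per node in expectation in order to achieve $\mathbf{E}[\|\nabla f(\hat x^K)\|^2]\le\varepsilon^2$, and the expected total communication cost per worker is $$\mathcal{O}\left(d+\frac{\Delta_0\zeta_{\mathcal Q}}{\varepsilon^2}\left(L\left(1+\sqrt{\frac{\omega\max\{d/\zeta_{\mathcal Q}-1,\,m/b'\}}{n}}\right)+\mathcal{L}\sqrt{\frac{(1+\omega)\max\{d/\zeta_{\mathcal Q}-1,\,m/b'\}}{nb'}}\right)\right)$$ under an assumption that the communication cost is proportional to the number of non-zero components of transmitted vectors from workers to the server.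
   Context: $\|\cdot\|$ is the Euclidean norm; $\|y\|_0$ is the number of non-zero components of $y\in\mathbb{R}^d$. Quantization operator: a stochastic mapping $\mathcal{Q}:\mathbb{R}^d\to\mathbb{R}^d$ for which there is $\omega>0$ with $\mathbf{E}[\mathcal{Q}(x)]=x$ and $\mathbf{E}[\|\mathcal{Q}(x)-x\|^2]\le\omega\|x\|^2$ for any $x\in\mathbb{R}^d$. Its expected density is $\zeta_{\mathcal Q}=\sup_{x\in\mathbb{R}^d}\mathbf{E}[\|\mathcal{Q}(x)\|_0]$. VR-MARINA, finite sum case (a distributed method with $n$ workers, worker $i$ having access to $f_i$, and a server; input: starting point $x^0$, stepsize $\gamma$, minibatch size $b'$, probability $p\in(0,1]$, number of iterations $K$): initialize $g^0=\nabla f(x^0)$. For $k=0,\dots,K-1$: sample $c_k\sim\mathrm{Bernoulli}(p)$ and broadcast $g^k$ to all workers; each worker $i=1,\dots,n$ in parallel computes $x^{k+1}=x^k-\gamma g^k$ and sets $g_i^{k+1}=\nabla f_i(x^{k+1})$ if $c_k=1$, and $g_i^{k+1}=g^k+\mathcal{Q}(\widetilde\Delta_i^k)$ otherwise, where $\widetilde\Delta_i^k=\frac1{b'}\sum_{j\in I'_{i,k}}(\nabla f_{ij}(x^{k+1})-\nabla f_{ij}(x^k))$ and $I'_{i,k}$ is the set of the indices in the minibatch, $|I'_{i,k}|=b'$; then $g^{k+1}=\frac1n\sum_{i=1}^n g_i^{k+1}$. Return $\hat x^K$ chosen uniformly at random from $\{x^k\}_{k=0}^{K-1}$. Average $\mathcal{L}$-smoothness: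 for all $k\ge0$ and $i\in\{1,\dots,n\}$, with $\Delta_i^k=\nabla f_i(x^{k+1})-\nabla f_i(x^k)$, one has $\mathbf{E}[\widetilde\Delta_i^k\mid x^k,x^{k+1}]=\Delta_i^k$ and $\mathbf{E}[\|\widetilde\Delta_i^k-\Delta_i^k\|^2\mid x^k,x^{k+1}]\le\frac{\mathcal{L}_i^2}{b'}\|x^{k+1}-x^k\|^2$ with some $\mathcal{L}_i\ge0$. A stochastic oracle call is the computation of one gradient $\nabla f_{ij}$ at one point.
   Formalization: The stepsize must be positive and the O-constant is 12/θ, where θ in (0,1] bounds the ratio of γ to its largest allowed value from below (with γ ≤ 0 or arbitrarily small γ the claim fails); the iteration bound is the maximum of 1 and the stated expression, since at least one iteration is needed. *)

theory Defs
  imports "HOL-Probability.Probability"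
begin

definition gradient :: "('a::real_inner \<Rightarrow> real) \<Rightarrow> 'a \<Rightarrow> 'a" where
  "gradient f x = (THE D. GDERIV f x :> D)"

definition nnz :: "real ^ 'd \<Rightarrow> nat" where
  "nnz y = card {l. y $ l \<noteq> 0}"

text \<open>A stochastic mapping is a jointly measurable map \<open>Q u x\<close> of the argument \<open>x\<close> and a random
  seed \<open>u\<close> with law \<open>U\<close>. Integrability is demanded because the integral of a
  non-integrable function is \<open>0\<close>.\<close>

definition quantization ::
    "'u measure \<Rightarrow> ('u \<Rightarrow> real ^ 'd \<Rightarrow> real ^ 'd) \<Rightarrow> real \<Rightarrow> bool" where
  "quantization U Q \<omega> \<longleftrightarrow>
     prob_space U \<and> 0 < \<omega> \<and>
     (\<lambda>(u, x). Q u x) \<in> U \<Otimes>\<^sub>M borel \<rightarrow>\<^sub>M borel \<and>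
     (\<forall>x. integrable U (\<lambda>u. Q u x) \<and> (\<integral>u. Q u x \<partial>U) = x \<and>
          integrable U (\<lambda>u. (norm (Q u x - x))\<^sup>2) \<and>
          (\<integral>u. (norm (Q u x - x))\<^sup>2 \<partial>U) \<le> \<omega> * (norm x)\<^sup>2)"

definition expected_density :: "'u measure \<Rightarrow> ('u \<Rightarrow> real ^ 'd \<Rightarrow> real ^ 'd) \<Rightarrow> real" where
  "expected_density U Q = (SUP x. \<integral>u. real (nnz (Q u x)) \<partial>U)"

definition local_loss :: "(nat \<Rightarrow> nat \<Rightarrow> 'a \<Rightarrow> real) \<Rightarrow> nat \<Rightarrow> nat \<Rightarrow> 'a \<Rightarrow> real" where
  "local_loss fs m i x = (\<Sum>j=1..m. fs i j x) / real m"

definition global_loss :: "(nat \<Rightarrow> nat \<Rightarrow> 'a \<Rightarrow> real) \<Rightarrow> nat \<Rightarrow> nat \<Rightarrow> 'a \<Rightarrow> real" where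
  "global_loss fs n m x = (\<Sum>i=1..n. local_loss fs m i x) / real n"

definition minibatch_diff ::
    "(nat \<Rightarrow> nat \<Rightarrow> 'a::real_inner \<Rightarrow> real) \<Rightarrow> nat \<Rightarrow> nat \<Rightarrow> nat set \<Rightarrow> 'a \<Rightarrow> 'a \<Rightarrow> 'a" where
  "minibatch_diff fs b i S x x' =
     (1 / real b) *\<^sub>R (\<Sum>j\<in>S. gradient (fs i j) x' - gradient (fs i j) x)"

text \<open>The randomness of a run on the probability space \<open>M\<close>: \<open>c k\<close> is the coin of iteration \<open>k\<close>,
  \<open>J i k\<close> the minibatch of worker \<open>i\<close>, \<open>s i k\<close> the seed of the quantizer of worker \<open>i\<close>, and
  \<open>\<tau> K\<close> the index of the point returned by the run with \<open>K\<close> iterations. The variables have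
  different value types, so independence is stated for the \<open>\<sigma>\<close>-algebras they generate. The
  output indices of runs of different lengths need not be independent of each other. The law of
  the minibatches is arbitrary; it is constrained by average smoothness only.\<close>

datatype source = Coin nat | Minibatch nat nat | Seed nat nat | Output

definition sources :: "nat \<Rightarrow> source set" where
  "sources n = {Output} \<union> range Coin \<union>
     {Minibatch i k |i k. i \<in> {1..n}} \<union> {Seed i k |i k. i \<in> {1..n}}"

definition generated :: "'w measure \<Rightarrow> 'b measure \<Rightarrow> ('w \<Rightarrow> 'b) \<Rightarrow> 'w set set" where
  "generated M N X = sets (vimage_algebra (space M) X N)"

definition sampling ::
    "'w measure \<Rightarrow> 'u measure \<Rightarrow> nat \<Rightarrow> nat \<Rightarrow> nat \<Rightarrow> real \<Rightarrow>
     (nat \<Rightarrow> 'w \<Rightarrow> bool) \<Rightarrow> (nat \<Rightarrow> nat \<Rightarrow> 'w \<Rightarrow> nat set) \<Rightarrow> (nat \<Rightarrow> nat \<Rightarrow> 'w \<Rightarrow> 'u) \<Rightarrow>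
     (nat \<Rightarrow> 'w \<Rightarrow> nat) \<Rightarrow> bool" where
  "sampling M U n m b p c J s \<tau> \<longleftrightarrow>
     prob_space M \<and>
     (\<forall>k. c k \<in> M \<rightarrow>\<^sub>M count_space UNIV \<and>
          distr M (count_space UNIV) (c k) = measure_pmf (bernoulli_pmf p)) \<and>
     (\<forall>k. \<forall>i\<in>{1..n}. J i k \<in> M \<rightarrow>\<^sub>M count_space {S. S \<subseteq> {1..m} \<and> card S = b}) \<and>
     (\<forall>k. \<forall>i\<in>{1..n}. s i k \<in> M \<rightarrow>\<^sub>M U \<and> distr M U (s i k) = U) \<and>
     (\<forall>K\<ge>1. \<tau> K \<in> M \<rightarrow>\<^sub>M count_space UNIV \<and>
          distr M (count_space UNIV) (\<tau> K) = measure_pmf (pmf_of_set {..<K}) \<and>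
          prob_space.indep_sets M
            (\<lambda>src. case src of
                Coin k \<Rightarrow> generated M (count_space UNIV) (c k)
              | Minibatch i k \<Rightarrow> generated M (count_space {S. S \<subseteq> {1..m} \<and> card S = b}) (J i k)
              | Seed i k \<Rightarrow> generated M U (s i k)
              | Output \<Rightarrow> generated M (count_space UNIV) (\<tau> K))
            (sources n))"

definition vr_marina ::
    "'w measure \<Rightarrow> (nat \<Rightarrow> nat \<Rightarrow> real ^ 'd \<Rightarrow> real) \<Rightarrow> nat \<Rightarrow> nat \<Rightarrow> nat \<Rightarrow>
     ('u \<Rightarrow> real ^ 'd \<Rightarrow> real ^ 'd) \<Rightarrow> real \<Rightarrow> real ^ 'd \<Rightarrow>
     (nat \<Rightarrow> 'w \<Rightarrow> bool) \<Rightarrow> (nat \<Rightarrow> nat \<Rightarrow> 'w \<Rightarrow> nat set) \<Rightarrow> (nat \<Rightarrow> nat \<Rightarrow> 'w \<Rightarrow> 'u) \<Rightarrow>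
     (nat \<Rightarrow> 'w \<Rightarrow> real ^ 'd) \<Rightarrow> (nat \<Rightarrow> 'w \<Rightarrow> real ^ 'd) \<Rightarrow> bool" where
  "vr_marina M fs n m b Q \<gamma> x0 c J s x g \<longleftrightarrow>
     (\<forall>w\<in>space M.
        x 0 w = x0 \<and> g 0 w = gradient (global_loss fs n m) x0 \<and>
        (\<forall>k. x (Suc k) w = x k w - \<gamma> *\<^sub>R g k w \<and>
             g (Suc k) w = (1 / real n) *\<^sub>R
               (\<Sum>i=1..n. if c k w then gradient (local_loss fs m i) (x (Suc k) w)
                          else g k w + Q (s i k w)
                                 (minibatch_diff fs b i (J i k w) (x k w) (x (Suc k) w)))))"

text \<open>The conditional expectation of a vector is taken componentwise. The second moment is
  conditioned in \<open>ennreal\<close>, where an infinite value is not collapsed to \<open>0\<close>.\<close>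

definition average_smooth ::
    "'w measure \<Rightarrow> (nat \<Rightarrow> nat \<Rightarrow> real ^ 'd \<Rightarrow> real) \<Rightarrow> nat \<Rightarrow> nat \<Rightarrow> nat \<Rightarrow>
     (nat \<Rightarrow> nat \<Rightarrow> 'w \<Rightarrow> nat set) \<Rightarrow> (nat \<Rightarrow> 'w \<Rightarrow> real ^ 'd) \<Rightarrow> (nat \<Rightarrow> real) \<Rightarrow> bool" where
  "average_smooth M fs n m b J x \<L> \<longleftrightarrow>
     (\<forall>k. \<forall>i\<in>{1..n}.
        let F = vimage_algebra (space M) (\<lambda>w. (x k w, x (Suc k) w)) borel;
            \<Delta>' = (\<lambda>w. minibatch_diff fs b i (J i k w) (x k w) (x (Suc k) w));
            \<Delta> = (\<lambda>w. gradient (local_loss fs m i) (x (Suc k) w)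
                      - gradient (local_loss fs m i) (x k w))
        in 0 \<le> \<L> i \<and>
           (\<forall>l. AE w in M. real_cond_exp M F (\<lambda>w. \<Delta>' w $ l) w = \<Delta> w $ l) \<and>
           (AE w in M. nn_cond_exp M F (\<lambda>w. ennreal ((norm (\<Delta>' w - \<Delta> w))\<^sup>2)) w
              \<le> ennreal ((\<L> i)\<^sup>2 / real b * (norm (x (Suc k) w - x k w))\<^sup>2)))"

text \<open>Cost of \<open>K\<close> iterations for worker \<open>i\<close>. The initial \<open>m\<close> (respectively the initial
  transmission) is for its share of \<open>g\<^sup>0\<close>; an index of a minibatch costs two calls, at the old
  and at the new point. Communication is measured in non-zero components sent to the server:
  a full local gradient if the coin is \<open>True\<close>, the quantized difference otherwise.\<close>

definition oracle_calls ::
    "nat \<Rightarrow> (nat \<Rightarrow> 'w \<Rightarrow> bool) \<Rightarrow> (nat \<Rightarrow> nat \<Rightarrow> 'w \<Rightarrow> nat set) \<Rightarrow> nat \<Rightarrow> nat \<Rightarrow> 'w \<Rightarrow> nat" where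
  "oracle_calls m c J K i w = m + (\<Sum>k<K. if c k w then m else 2 * card (J i k w))"

definition communication ::
    "(nat \<Rightarrow> nat \<Rightarrow> real ^ 'd \<Rightarrow> real) \<Rightarrow> nat \<Rightarrow> nat \<Rightarrow> ('u \<Rightarrow> real ^ 'd \<Rightarrow> real ^ 'd) \<Rightarrow>
     (nat \<Rightarrow> 'w \<Rightarrow> bool) \<Rightarrow> (nat \<Rightarrow> nat \<Rightarrow> 'w \<Rightarrow> nat set) \<Rightarrow> (nat \<Rightarrow> nat \<Rightarrow> 'w \<Rightarrow> 'u) \<Rightarrow>
     (nat \<Rightarrow> 'w \<Rightarrow> real ^ 'd) \<Rightarrow> nat \<Rightarrow> nat \<Rightarrow> 'w \<Rightarrow> nat" where
  "communication fs m b Q c J s x K i w =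
     nnz (gradient (local_loss fs m i) (x 0 w)) +
     (\<Sum>k<K. if c k w then nnz (gradient (local_loss fs m i) (x (Suc k) w))
             else nnz (Q (s i k w) (minibatch_diff fs b i (J i k w) (x k w) (x (Suc k) w))))"

text \<open>The constant hidden in the \<open>O\<close>-bounds. It has to be the same for all dimensions, and an
  existential quantifier could not express this because the dimension is a type; hence it is
  given explicitly. The parameter \<open>\<theta>\<close> is a lower bound for the ratio between the stepsize and the
  largest admissible stepsize; no \<open>O\<close>-bound holds uniformly over arbitrarily small stepsizes.\<close>

definition O_const :: "real \<Rightarrow> real" where
  "O_const \<theta> = 12 / \<theta>"

end

theory Submission
  imports Defs
begin

text \<open>Let \<open>e\<^sub>k = g\<^sup>k - \<nabla>f(x\<^sup>k)\<close>. It vanishes if the coin shows \<open>True\<close>; otherwise it changes by the average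
  over the workers of \<open>Q(\<Delta>'\<^sub>i) - \<Delta>\<^sub>i\<close>, where \<open>\<Delta>'\<^sub>i\<close> is the minibatch difference. By independence and
  unbiasedness of the quantizers and of the minibatches these errors are orthogonal to \<open>e\<^sub>k\<close> and to
  each other, so \<open>E \<parallel>e\<^sub>k\<^sub>+\<^sub>1\<parallel>\<^sup>2 \<le> (1 - p) (E \<parallel>e\<^sub>k\<parallel>\<^sup>2 + B E \<parallel>x\<^sup>k\<^sup>+\<^sup>1 - x\<^sup>k\<parallel>\<^sup>2)\<close> with
  \<open>B = (\<omega> L\<^sup>2 + (1 + \<omega>) \<L>\<^sup>2 / b) / n\<close>. Together with the descent inequality for the \<open>L\<close>-smooth
  function \<open>f\<close> this makes \<open>E f(x\<^sup>k) + \<gamma> / (2p) E \<parallel>e\<^sub>k\<parallel>\<^sup>2\<close> decrease by \<open>\<gamma> / 2 E \<parallel>\<nabla>f(x\<^sup>k)\<parallel>\<^sup>2\<close> per step; the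
  stepsize condition allows the terms \<open>E \<parallel>x\<^sup>k\<^sup>+\<^sup>1 - x\<^sup>k\<parallel>\<^sup>2\<close> to be dropped, because
  \<open>(1 - p) / p = max {d / \<zeta> - 1, m / b}\<close>. Hence \<open>E \<parallel>\<nabla>f\<parallel>\<^sup>2 \<le> 2 \<Delta>0 / (\<gamma> K)\<close> at the returned point. In one
  iteration a worker spends at most \<open>p m + 2 b \<le> 3 b\<close> oracle calls and \<open>p d + \<zeta> \<le> 2 \<zeta>\<close> transmitted
  components in expectation.\<close>

section \<open>Gradients\<close>

lemma gradient_eqI:
  assumes "GDERIV f x :> D"
  shows "gradient f x = D"
  unfolding gradient_def
proof (rule the_equality)
  show "GDERIV f x :> D" by (rule assms)
next
  fix E assume "GDERIV f x :> E"
  with assms have "(\<lambda>h. h \<bullet> E) = (\<lambda>h. h \<bullet> D)"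
    unfolding gderiv_def using has_derivative_unique by blast
  \<comment> \<open>Testing both derivatives on the direction \<open>E - D\<close> turns the
    equality of the two linear forms into orthogonality of \<open>E - D\<close> to itself.\<close>
  then have "(E - D) \<bullet> E = (E - D) \<bullet> D" by metis
  then have "(E - D) \<bullet> (E - D) = 0" by (simp add: inner_diff_right)
  then show "E = D" by simp
qed

text \<open>The Riesz vector of the derivative, assembled from its values on \<open>Basis\<close>,
  is a gradient; by uniqueness the description operator in \<open>gradient\<close> picks it
  out.\<close>

lemma GDERIV_gradient:
  fixes f :: "'a::euclidean_space \<Rightarrow> real"
  assumes "f differentiable (at x)"
  shows "GDERIV f x :> gradient f x"
proof -
  obtain f' where f': "(f has_derivative f') (at x)"
    using assms by (auto simp: differentiable_def)
  have lin: "linear f'" using f' by (rule has_derivative_linear)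
  have "f' = (\<lambda>h. h \<bullet> (\<Sum>b\<in>Basis. f' b *\<^sub>R b))"
  proof
    fix h
    have "f' h = f' (\<Sum>b\<in>Basis. (h \<bullet> b) *\<^sub>R b)" by (simp add: euclidean_representation)
    also have "\<dots> = (\<Sum>b\<in>Basis. (h \<bullet> b) * f' b)"
      using lin by (simp add: linear_sum linear_cmul)
    finally show "f' h = h \<bullet> (\<Sum>b\<in>Basis. f' b *\<^sub>R b)"
      by (simp add: inner_sum_right mult.commute)
  qed
  with f' have "GDERIV f x :> (\<Sum>b\<in>Basis. f' b *\<^sub>R b)"
    unfolding gderiv_def by simp
  then show ?thesis using gradient_eqI by metis
qed

lemma GDERIV_sum:
  "(\<And>i. i \<in> I \<Longrightarrow> GDERIV (f i) x :> D i) \<Longrightarrow> GDERIV (\<lambda>x. \<Sum>i\<in>I. f i x) x :> (\<Sum>i\<in>I. D i)"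
  unfolding gderiv_def inner_sum_right by (rule has_derivative_sum)

lemma GDERIV_divide:
  assumes "GDERIV f x :> D"
  shows "GDERIV (\<lambda>x. f x / c) x :> (1 / c) *\<^sub>R D"
proof -
  have "((\<lambda>x. f x * (1 / c)) has_derivative (\<lambda>h. (h \<bullet> D) * (1 / c))) (at x)"
    using assms unfolding gderiv_def by (rule has_derivative_mult_left)
  then show ?thesis unfolding gderiv_def by simp
qed

lemma GDERIV_line:
  assumes "GDERIV f (x + t *\<^sub>R v) :> D"
  shows "((\<lambda>t. f (x + t *\<^sub>R v)) has_real_derivative v \<bullet> D) (at t)"
proof -
  have "((\<lambda>t. f (x + t *\<^sub>R v)) has_derivative (\<lambda>h. (h *\<^sub>R v) \<bullet> D)) (at t)"
    by (rule has_derivative_compose[where f = "\<lambda>t. x + t *\<^sub>R v" and g = f])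
      (use assms in \<open>auto intro!: derivative_eq_intros simp: gderiv_def\<close>)
  moreover have "(\<lambda>h. (h *\<^sub>R v) \<bullet> D) = (*) (v \<bullet> D)" by (simp add: fun_eq_iff)
  ultimately show ?thesis by (simp only: has_field_derivative_def)
qed

text \<open>For the single summands \<open>fs i j\<close> no continuity of the gradient is assumed.
  Each component is still a pointwise limit of difference quotients with increments
  \<open>1 / Suc k\<close>, which are measurable because \<open>f\<close> is continuous.\<close>

lemma borel_measurable_gradient:
  fixes f :: "'a::euclidean_space \<Rightarrow> real"
  assumes "\<And>x. f differentiable (at x)"
  shows "gradient f \<in> borel_measurable borel"
proof -
  have "continuous_on UNIV f"
    by (meson assms continuous_at_imp_continuous_on differentiable_imp_continuous_within)
  then have [measurable]: "f \<in> borel_measurable borel" by (rule borel_measurable_continuous_onI)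
  show ?thesis
    unfolding borel_measurable_euclidean_space[of "gradient f"]
  proof
    fix e :: 'a assume "e \<in> Basis"
    show "(\<lambda>x. gradient f x \<bullet> e) \<in> borel_measurable borel"
    proof (rule borel_measurable_LIMSEQ_real)
      fix x
      have "((\<lambda>t. f (x + t *\<^sub>R e)) has_real_derivative e \<bullet> gradient f x) (at 0)"
        by (rule GDERIV_line) (simp add: GDERIV_gradient assms)
      then have "((\<lambda>h. (f (x + h *\<^sub>R e) - f x) / h) \<longlongrightarrow> e \<bullet> gradient f x) (at 0)"
        by (simp add: DERIV_def)
      moreover have "filterlim (\<lambda>k. 1 / real (Suc k)) (at 0) sequentially"
        unfolding filterlim_at using LIMSEQ_inverse_real_of_nat
        by (auto simp: inverse_eq_divide simp del: of_nat_Suc)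
      ultimately have "(\<lambda>k. (f (x + (1 / real (Suc k)) *\<^sub>R e) - f x) / (1 / real (Suc k)))
          \<longlonglongrightarrow> e \<bullet> gradient f x"
        by (rule filterlim_compose)
      then show "(\<lambda>k. (f (x + (1 / real (Suc k)) *\<^sub>R e) - f x) / (1 / real (Suc k)))
          \<longlonglongrightarrow> gradient f x \<bullet> e"
        by (simp add: inner_commute)
    qed measurable
  qed
qed

text \<open>\<open>\<phi>\<close> is \<open>f\<close> along the segment minus the linear and
  quadratic terms of the bound. Cauchy-Schwarz and the Lipschitz condition make its derivative
  nonpositive, and comparing the end points of the segment gives the claim.\<close>

lemma smooth_upper_bound:
  fixes f :: "'a::euclidean_space \<Rightarrow> real"
  assumes diff: "\<And>x. f differentiable (at x)"
    and lip: "\<And>x y. norm (gradient f x - gradient f y) \<le> L * norm (x - y)"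
  shows "f (x + v) \<le> f x + v \<bullet> gradient f x + L / 2 * (norm v)\<^sup>2"
proof -
  define \<phi> where "\<phi> t = f (x + t *\<^sub>R v) - t * (v \<bullet> gradient f x) - L / 2 * t\<^sup>2 * (norm v)\<^sup>2" for t
  have "\<phi> 1 \<le> \<phi> 0"
  proof (rule DERIV_nonpos_imp_nonincreasing[where f = \<phi> and a = 0 and b = 1])
    fix t :: real assume t: "0 \<le> t" "t \<le> 1"
    let ?D = "v \<bullet> gradient f (x + t *\<^sub>R v) - v \<bullet> gradient f x - L * t * (norm v)\<^sup>2"
    have "(\<phi> has_real_derivative ?D) (at t)"
      unfolding \<phi>_def
      by (auto intro!: derivative_eq_intros GDERIV_line GDERIV_gradient diff)
    moreover have "?D \<le> 0"
    proof -
      have "v \<bullet> gradient f (x + t *\<^sub>R v) - v \<bullet> gradient f x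
          \<le> norm v * norm (gradient f (x + t *\<^sub>R v) - gradient f x)"
        by (simp add: inner_diff_right[symmetric] norm_cauchy_schwarz)
      also have "\<dots> \<le> norm v * (L * norm (t *\<^sub>R v))"
        using lip[of "x + t *\<^sub>R v" x] by (intro mult_left_mono) auto
      also have "\<dots> = L * t * (norm v)\<^sup>2" using t by (simp add: power2_eq_square)
      finally show ?thesis by simp
    qed
    ultimately show "\<exists>y. (\<phi> has_real_derivative y) (at t) \<and> y \<le> 0" by blast
  qed simp
  then show ?thesis by (simp add: \<phi>_def)
qed

text \<open>Polarization replaces the inner product of \<open>g\<close> with the gradient by squared
  norms. The term in \<open>norm g\<close> is merged with the smoothness term, so that the step
  length appears with a coefficient that is nonnegative once
  \<open>\<gamma> * L \<le> 1\<close>.\<close>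

lemma gradient_descent_bound:
  fixes f :: "'a::euclidean_space \<Rightarrow> real"
  assumes "\<And>x. f differentiable (at x)"
    and "\<And>x y. norm (gradient f x - gradient f y) \<le> L * norm (x - y)"
    and "0 < \<gamma>"
  shows "f (x - \<gamma> *\<^sub>R g) \<le> f x - \<gamma> / 2 * (norm (gradient f x))\<^sup>2
    + \<gamma> / 2 * (norm (g - gradient f x))\<^sup>2 - (1 / (2 * \<gamma>) - L / 2) * (norm (\<gamma> *\<^sub>R g))\<^sup>2"
proof -
  have "f (x - \<gamma> *\<^sub>R g) \<le> f x - \<gamma> * (g \<bullet> gradient f x) + L / 2 * (norm (\<gamma> *\<^sub>R g))\<^sup>2"
    using smooth_upper_bound[OF assms(1,2), of x "- (\<gamma> *\<^sub>R g)"] by simp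
  moreover have "\<gamma> * (g \<bullet> gradient f x)
      = \<gamma> / 2 * (norm g)\<^sup>2 + \<gamma> / 2 * (norm (gradient f x))\<^sup>2 - \<gamma> / 2 * (norm (g - gradient f x))\<^sup>2"
    by (simp add: power2_norm_eq_inner algebra_simps inner_commute)
  moreover have "(1 / (2 * \<gamma>)) * (norm (\<gamma> *\<^sub>R g))\<^sup>2 = \<gamma> / 2 * (norm g)\<^sup>2"
    using assms(3) by (simp add: power_mult_distrib power2_eq_square)
  ultimately show ?thesis by (simp add: left_diff_distrib)
qed

text \<open>With Lipschitz constant 0 the bound \<open>smooth_upper_bound\<close> is affine, and an
  affine bound with nonzero slope falls below any \<open>c\<close>. This serves the degenerate case
  of a vanishing denominator in the stepsize condition.\<close>

lemma gradient_eq_0_of_bounded_below: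
  fixes f :: "'a::euclidean_space \<Rightarrow> real"
  assumes "\<And>x. f differentiable (at x)"
    and "\<And>x y. norm (gradient f x - gradient f y) \<le> 0"
    and low: "\<And>x. c \<le> f x"
  shows "gradient f x = 0"
proof (rule ccontr)
  let ?G = "(norm (gradient f x))\<^sup>2"
  assume "gradient f x \<noteq> 0"
  then have G: "0 < ?G" by simp
  \<comment> \<open>Chosen so that the decrease \<open>t * ?G\<close> is \<open>f x - c + 1\<close>,
    one more than the lower bound \<open>c\<close> permits.\<close>
  define t where "t = (f x - c + 1) / ?G"
  have "c \<le> f (x + (- t) *\<^sub>R gradient f x)" by (rule low)
  also have "\<dots> \<le> f x - t * ?G"
    using smooth_upper_bound[of f 0 x "(- t) *\<^sub>R gradient f x"] assms
    by (simp add: power2_norm_eq_inner)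
  also have "\<dots> = c - 1" using G unfolding t_def by simp
  finally show False by simp
qed

section \<open>Gradients of the averaged losses\<close>

lemma GDERIV_local_loss:
  fixes fs :: "nat \<Rightarrow> nat \<Rightarrow> 'a::euclidean_space \<Rightarrow> real"
  assumes "\<And>j. j \<in> {1..m} \<Longrightarrow> fs i j differentiable (at y)"
  shows "GDERIV (local_loss fs m i) y :> gradient (local_loss fs m i) y"
proof -
  have "GDERIV (local_loss fs m i) y :> (1 / real m) *\<^sub>R (\<Sum>j=1..m. gradient (fs i j) y)"
    unfolding local_loss_def by (intro GDERIV_divide GDERIV_sum GDERIV_gradient assms)
  then show ?thesis using gradient_eqI by metis
qed

lemma GDERIV_global_loss:
  fixes fs :: "nat \<Rightarrow> nat \<Rightarrow> 'a::euclidean_space \<Rightarrow> real"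
  assumes "\<And>i j. i \<in> {1..n} \<Longrightarrow> j \<in> {1..m} \<Longrightarrow> fs i j differentiable (at y)"
  shows "GDERIV (global_loss fs n m) y :>
    (1 / real n) *\<^sub>R (\<Sum>i=1..n. gradient (local_loss fs m i) y)"
  unfolding global_loss_def
  by (intro GDERIV_divide GDERIV_sum GDERIV_local_loss) (use assms in auto)

lemma gradient_global_loss:
  fixes fs :: "nat \<Rightarrow> nat \<Rightarrow> 'a::euclidean_space \<Rightarrow> real"
  assumes "\<And>i j. i \<in> {1..n} \<Longrightarrow> j \<in> {1..m} \<Longrightarrow> fs i j differentiable (at y)"
  shows "gradient (global_loss fs n m) y = (1 / real n) *\<^sub>R (\<Sum>i=1..n. gradient (local_loss fs m i) y)"
  using GDERIV_global_loss[OF assms] by (intro gradient_eqI) simp_all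

section \<open>Density of a quantizer\<close>

lemma nnz_le_CARD: "nnz (y :: real ^ 'd) \<le> CARD('d)"
  unfolding nnz_def by (rule card_mono) auto

lemma borel_measurable_nnz [measurable]: "(\<lambda>y :: real ^ 'd. real (nnz y)) \<in> borel_measurable borel"
proof -
  have "(\<lambda>y :: real ^ 'd. real (nnz y)) = (\<lambda>y. \<Sum>l\<in>UNIV. if y $ l \<noteq> 0 then 1 else 0)"
    by (simp add: nnz_def sum.If_cases fun_eq_iff)
  then show ?thesis by simp
qed

lemma quantization_measurable:
  fixes Q :: "'u \<Rightarrow> real ^ 'd \<Rightarrow> real ^ 'd"
  assumes "quantization U Q \<omega>"
  shows "(\<lambda>z. Q (fst z) (snd z)) \<in> U \<Otimes>\<^sub>M borel \<rightarrow>\<^sub>M borel" "(\<lambda>u. Q u x) \<in> U \<rightarrow>\<^sub>M borel"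
proof -
  show *: "(\<lambda>z. Q (fst z) (snd z)) \<in> U \<Otimes>\<^sub>M borel \<rightarrow>\<^sub>M borel"
    using assms by (simp add: quantization_def split_beta')
  have "(\<lambda>u. (u, x)) \<in> U \<rightarrow>\<^sub>M U \<Otimes>\<^sub>M borel" by simp
  from measurable_compose[OF this *] show "(\<lambda>u. Q u x) \<in> U \<rightarrow>\<^sub>M borel" by simp
qed

text \<open>All values are at most the dimension, so the supremum is taken over a bounded set. It is
  positive because density zero at the all-ones vector \<open>y\<close> would make
  \<open>Q u y\<close> vanish almost surely, against unbiasedness.\<close>

lemma
  fixes Q :: "'u \<Rightarrow> real ^ 'd \<Rightarrow> real ^ 'd"
  assumes Q: "quantization U Q \<omega>"
  shows density_le_expected_density: "(\<integral>u. real (nnz (Q u x)) \<partial>U) \<le> expected_density U Q"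
    and expected_density_le: "expected_density U Q \<le> real CARD('d)"
    and expected_density_pos: "0 < expected_density U Q"
proof -
  interpret U: prob_space U using Q by (simp add: quantization_def)
  note [measurable] = quantization_measurable[OF Q]
  have int: "integrable U (\<lambda>u. real (nnz (Q u x)))" for x
    by (rule U.integrable_const_bound[where B = "real CARD('d)"]) (auto simp: nnz_le_CARD)
  have le: "(\<integral>u. real (nnz (Q u x)) \<partial>U) \<le> real CARD('d)" for x
    using integral_mono[OF int[of x], of "\<lambda>_. real CARD('d)"] by (simp add: nnz_le_CARD U.prob_space)
  have bdd: "bdd_above (range (\<lambda>x. \<integral>u. real (nnz (Q u x)) \<partial>U))"
    using le by (intro bdd_aboveI2)
  show up: "(\<integral>u. real (nnz (Q u x)) \<partial>U) \<le> expected_density U Q" for x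
    unfolding expected_density_def using bdd by (rule cSUP_upper[OF UNIV_I])
  show "expected_density U Q \<le> real CARD('d)"
    unfolding expected_density_def using le by (intro cSUP_least) auto
  define y :: "real ^ 'd" where "y = (\<chi> i. 1)"
  have "0 \<noteq> y" by (simp add: y_def vec_eq_iff)
  have "(\<integral>u. real (nnz (Q u y)) \<partial>U) \<noteq> 0"
  proof
    assume "(\<integral>u. real (nnz (Q u y)) \<partial>U) = 0"
    then have "AE u in U. real (nnz (Q u y)) = 0"
      using int by (subst (asm) integral_nonneg_eq_0_iff_AE) auto
    then have "AE u in U. Q u y = 0"
      by eventually_elim (simp add: nnz_def vec_eq_iff)
    then have "(\<integral>u. Q u y \<partial>U) = 0"
      by (subst integral_cong_AE[where g = "\<lambda>_. 0"]) auto
    then show False using Q \<open>0 \<noteq> y\<close> by (simp add: quantization_def)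
  qed
  moreover have "0 \<le> (\<integral>u. real (nnz (Q u y)) \<partial>U)" by simp
  ultimately show "0 < expected_density U Q" using up[of y] by linarith
qed


section \<open>Square-integrable random vectors\<close>

text \<open>A class closed under the operations of the algorithm and in which inner products are
  integrable, so that orthogonality of errors is meaningful. Measurability is included since
  integrability of the squared norm does not imply it.\<close>

definition square_integrable :: "'w measure \<Rightarrow> ('w \<Rightarrow> 'a::euclidean_space) \<Rightarrow> bool" where
  "square_integrable M X \<longleftrightarrow> X \<in> borel_measurable M \<and> integrable M (\<lambda>w. (norm (X w))\<^sup>2)"

lemma square_integrableD:
  assumes "square_integrable M X"
  shows "X \<in> borel_measurable M" "integrable M (\<lambda>w. (norm (X w))\<^sup>2)"
  using assms by (auto simp: square_integrable_def)

lemma square_integrable_bound: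
  assumes "integrable M h" "X \<in> borel_measurable M" "\<And>w. w \<in> space M \<Longrightarrow> (norm (X w))\<^sup>2 \<le> h w"
  shows "square_integrable M X"
  unfolding square_integrable_def
proof
  show "integrable M (\<lambda>w. (norm (X w))\<^sup>2)"
    by (rule Bochner_Integration.integrable_bound[OF assms(1)])
      (use assms(2,3) in \<open>force intro!: AE_I2\<close>)+
qed (rule assms(2))

lemma square_integrable_cong:
  assumes "\<And>w. w \<in> space M \<Longrightarrow> X w = Y w"
  shows "square_integrable M X \<longleftrightarrow> square_integrable M Y"
  unfolding square_integrable_def
  using assms by (intro conj_cong measurable_cong Bochner_Integration.integrable_cong) auto

text \<open>Parallelogram identity with the square of the difference dropped.\<close>

lemma norm_add_power2_le: "(norm (x + y))\<^sup>2 \<le> 2 * (norm x)\<^sup>2 + 2 * (norm (y :: 'a::real_inner))\<^sup>2"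
proof -
  have "(norm (x + y))\<^sup>2 + (norm (x - y))\<^sup>2 = 2 * (norm x)\<^sup>2 + 2 * (norm y)\<^sup>2"
    by (simp add: power2_norm_eq_inner algebra_simps inner_commute)
  then show ?thesis by (smt (verit) zero_le_power2)
qed

lemma square_integrable_add [intro]:
  assumes "square_integrable M X" "square_integrable M Y"
  shows "square_integrable M (\<lambda>w. X w + Y w)"
proof (rule square_integrable_bound)
  note [measurable] = assms[THEN square_integrableD(1)]
  show "(\<lambda>w. X w + Y w) \<in> borel_measurable M" by measurable
  show "integrable M (\<lambda>w. 2 * (norm (X w))\<^sup>2 + 2 * (norm (Y w))\<^sup>2)"
    using assms[THEN square_integrableD(2)] by auto
qed (rule norm_add_power2_le)

lemma square_integrable_scaleR [intro]:
  assumes "square_integrable M X"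
  shows "square_integrable M (\<lambda>w. c *\<^sub>R X w)"
  using assms unfolding square_integrable_def by (auto simp: power_mult_distrib)

lemma square_integrable_diff [intro]:
  assumes "square_integrable M X" "square_integrable M Y"
  shows "square_integrable M (\<lambda>w. X w - Y w)"
  using square_integrable_add[OF assms(1) square_integrable_scaleR[OF assms(2), of "-1"]] by simp

lemma square_integrable_const [intro]: "finite_measure M \<Longrightarrow> square_integrable M (\<lambda>_. c)"
  unfolding square_integrable_def by (simp add: finite_measure.integrable_const)

lemma square_integrable_sum [intro]:
  assumes "finite_measure M" "\<And>i. i \<in> I \<Longrightarrow> square_integrable M (X i)"
  shows "square_integrable M (\<lambda>w. \<Sum>i\<in>I. X i w)"
  using assms(2)
  by (induction I rule: infinite_finite_induct)
    (auto intro: square_integrable_const[OF assms(1)])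

lemma square_integrable_If:
  assumes "square_integrable M X" "square_integrable M Y" "Measurable.pred M P"
  shows "square_integrable M (\<lambda>w. if P w then X w else Y w)"
proof (rule square_integrable_bound)
  note [measurable] = assms(1,2)[THEN square_integrableD(1)] assms(3)
  show "(\<lambda>w. if P w then X w else Y w) \<in> borel_measurable M" by measurable
  show "integrable M (\<lambda>w. (norm (X w))\<^sup>2 + (norm (Y w))\<^sup>2)"
    using assms(1,2)[THEN square_integrableD(2)] by auto
qed auto

lemma square_integrable_inner [intro]:
  fixes X Y :: "'w \<Rightarrow> 'a::euclidean_space"
  assumes "square_integrable M X" "square_integrable M Y"
  shows "integrable M (\<lambda>w. X w \<bullet> Y w)"
proof (rule Bochner_Integration.integrable_bound)
  note [measurable] = assms[THEN square_integrableD(1)]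
  show "integrable M (\<lambda>w. (norm (X w))\<^sup>2 + (norm (Y w))\<^sup>2)"
    using assms[THEN square_integrableD(2)] by auto
  have "\<bar>x \<bullet> y\<bar> \<le> (norm x)\<^sup>2 + (norm y)\<^sup>2" for x y :: 'a
  proof -
    have "\<bar>x \<bullet> y\<bar> \<le> norm x * norm y" by (rule Cauchy_Schwarz_ineq2)
    also have "\<dots> \<le> (norm x)\<^sup>2 + (norm y)\<^sup>2"
      using sum_squares_bound[of "norm x" "norm y"] mult_nonneg_nonneg[of "norm x" "norm y"]
      unfolding mult.assoc by (smt (verit) norm_ge_zero)
    finally show ?thesis .
  qed
  then show "AE w in M. norm (X w \<bullet> Y w) \<le> norm ((norm (X w))\<^sup>2 + (norm (Y w))\<^sup>2)"
    by simp
qed (use assms[THEN square_integrableD(1)] in measurable)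

lemma square_integrable_integrable:
  fixes X :: "'w \<Rightarrow> 'a::euclidean_space"
  assumes "finite_measure M" "square_integrable M X"
  shows "integrable M X"
proof (rule Bochner_Integration.integrable_bound)
  show "integrable M (\<lambda>w. 1 + (norm (X w))\<^sup>2)"
    using assms by (auto dest: square_integrableD simp: finite_measure.integrable_const)
  have "t \<le> 1 + t\<^sup>2" for t :: real
    using sum_squares_bound[of t 1] by (smt (verit) power_one zero_le_power2 mult_cancel_left1)
  then show "AE w in M. norm (X w) \<le> norm (1 + (norm (X w))\<^sup>2)" by simp
qed (use assms in \<open>auto dest: square_integrableD\<close>)

text \<open>Comparison with \<open>h 0\<close> shows that a Lipschitz map grows at most linearly, so
  it preserves finite second moments on a finite measure.\<close>

lemma square_integrable_lipschitz:
  assumes "finite_measure M" "square_integrable M X" "h \<in> borel_measurable borel"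
    and lip: "\<And>x y. norm (h x - h y) \<le> L * norm (x - y)"
  shows "square_integrable M (\<lambda>w. h (X w))"
proof (rule square_integrable_bound)
  show "(\<lambda>w. h (X w)) \<in> borel_measurable M"
    using assms(2,3) by (auto dest: square_integrableD)
  show "integrable M (\<lambda>w. 2 * (L\<^sup>2 * (norm (X w))\<^sup>2) + 2 * (norm (h 0))\<^sup>2)"
    using assms(1,2) by (auto dest: square_integrableD simp: finite_measure.integrable_const)
  fix w
  have "(norm (h (X w)))\<^sup>2 \<le> 2 * (norm (h (X w) - h 0))\<^sup>2 + 2 * (norm (h 0))\<^sup>2"
    using norm_add_power2_le[of "h (X w) - h 0" "h 0"] by simp
  moreover have "(norm (h (X w) - h 0))\<^sup>2 \<le> (L * norm (X w))\<^sup>2"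
    using lip[of "X w" 0] by (intro power_mono) auto
  ultimately show "(norm (h (X w)))\<^sup>2 \<le> 2 * (L\<^sup>2 * (norm (X w))\<^sup>2) + 2 * (norm (h 0))\<^sup>2"
    by (simp add: power_mult_distrib)
qed

lemma integral_norm_add_orthogonal:
  assumes "square_integrable M X" "square_integrable M Y" "(\<integral>w. X w \<bullet> Y w \<partial>M) = 0"
  shows "(\<integral>w. (norm (X w + Y w))\<^sup>2 \<partial>M) = (\<integral>w. (norm (X w))\<^sup>2 \<partial>M) + (\<integral>w. (norm (Y w))\<^sup>2 \<partial>M)"
proof -
  have "(\<integral>w. (norm (X w + Y w))\<^sup>2 \<partial>M)
      = (\<integral>w. (norm (X w))\<^sup>2 + (norm (Y w))\<^sup>2 + 2 * (X w \<bullet> Y w) \<partial>M)"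
    by (rule Bochner_Integration.integral_cong)
      (auto simp: power2_norm_eq_inner algebra_simps inner_commute)
  also have "\<dots> = (\<integral>w. (norm (X w))\<^sup>2 \<partial>M) + (\<integral>w. (norm (Y w))\<^sup>2 \<partial>M) + 2 * (\<integral>w. X w \<bullet> Y w \<partial>M)"
    using square_integrable_inner[OF assms(1,2)] assms(1,2)
    by (simp add: square_integrableD)
  finally show ?thesis using assms(3) by simp
qed

lemma integral_inner_sum:
  assumes "square_integrable M B" "\<And>i. i \<in> I \<Longrightarrow> square_integrable M (X i)"
  shows "(\<integral>w. B w \<bullet> (\<Sum>i\<in>I. X i w) \<partial>M) = (\<Sum>i\<in>I. \<integral>w. B w \<bullet> X i w \<partial>M)"
  unfolding inner_sum_right
  using assms by (intro Bochner_Integration.integral_sum) auto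

text \<open>Pythagoras by induction over the index set. Applied to the workers, it makes their
  errors add up in square, so that averaging gains a factor \<open>1 / n\<close>.\<close>

lemma integral_norm_sum_orthogonal:
  assumes "finite_measure M" "finite I" "\<And>i. i \<in> I \<Longrightarrow> square_integrable M (X i)"
    and "\<And>i j. i \<in> I \<Longrightarrow> j \<in> I \<Longrightarrow> i \<noteq> j \<Longrightarrow> (\<integral>w. X i w \<bullet> X j w \<partial>M) = 0"
  shows "(\<integral>w. (norm (\<Sum>i\<in>I. X i w))\<^sup>2 \<partial>M) = (\<Sum>i\<in>I. \<integral>w. (norm (X i w))\<^sup>2 \<partial>M)"
  using assms(2-4)
proof (induction I)
  case (insert i I)
  have "(\<integral>w. (norm (X i w + (\<Sum>j\<in>I. X j w)))\<^sup>2 \<partial>M)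
      = (\<integral>w. (norm (X i w))\<^sup>2 \<partial>M) + (\<integral>w. (norm (\<Sum>j\<in>I. X j w))\<^sup>2 \<partial>M)"
  proof (rule integral_norm_add_orthogonal)
    have "(\<integral>w. X i w \<bullet> (\<Sum>j\<in>I. X j w) \<partial>M) = (\<Sum>j\<in>I. \<integral>w. X i w \<bullet> X j w \<partial>M)"
      by (rule integral_inner_sum) (use insert.prems in auto)
    also have "\<dots> = 0"
      by (intro sum.neutral ballI insert.prems(2)) (use insert.hyps in auto)
    finally show "(\<integral>w. X i w \<bullet> (\<Sum>j\<in>I. X j w) \<partial>M) = 0" .
  qed (use insert.prems assms(1) in auto)
  then show ?case using insert by simp
qed simp

section \<open>Independence\<close>

context prob_space
begin

text \<open>The library's notion of two independent variables demands a common value type.\<close>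

definition indep_pair :: "'b measure \<Rightarrow> ('a \<Rightarrow> 'b) \<Rightarrow> 'c measure \<Rightarrow> ('a \<Rightarrow> 'c) \<Rightarrow> bool" where
  "indep_pair S X T Y \<longleftrightarrow> X \<in> M \<rightarrow>\<^sub>M S \<and> Y \<in> M \<rightarrow>\<^sub>M T \<and>
     distr M (S \<Otimes>\<^sub>M T) (\<lambda>w. (X w, Y w)) = distr M S X \<Otimes>\<^sub>M distr M T Y"

lemma indep_pairD:
  assumes "indep_pair S X T Y"
  shows "distr M (S \<Otimes>\<^sub>M T) (\<lambda>w. (X w, Y w)) = distr M S X \<Otimes>\<^sub>M distr M T Y"
    "X \<in> M \<rightarrow>\<^sub>M S" "Y \<in> M \<rightarrow>\<^sub>M T"
  using assms by (auto simp: indep_pair_def)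

text \<open>Fubini for the product law: the first variable is frozen and only the second is
  averaged. Later the second is a fresh minibatch or seed, and the first is whatever was determined
  without it.\<close>

lemma indep_pair_integral:
  fixes h :: "_ \<Rightarrow> _::{banach, second_countable_topology}"
  assumes ind: "indep_pair S X T Y"
    and [measurable]: "h \<in> borel_measurable (S \<Otimes>\<^sub>M T)"
    and int: "integrable M (\<lambda>w. h (X w, Y w))"
  shows "(\<integral>w. h (X w, Y w) \<partial>M) = (\<integral>w. (\<integral>t. h (X w, t) \<partial>distr M T Y) \<partial>M)"
proof -
  note D = indep_pairD[OF ind]
  note [measurable] = D(2,3)
  interpret X: prob_space "distr M S X" by (rule prob_space_distr) (rule D)
  interpret Y: prob_space "distr M T Y" by (rule prob_space_distr) (rule D)
  interpret P: pair_sigma_finite "distr M S X" "distr M T Y" ..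
  have i: "integrable (distr M S X \<Otimes>\<^sub>M distr M T Y) h"
    using int by (subst D(1)[symmetric], subst integrable_distr_eq) auto
  have "(\<integral>w. h (X w, Y w) \<partial>M) = integral\<^sup>L (distr M (S \<Otimes>\<^sub>M T) (\<lambda>w. (X w, Y w))) h"
    by (subst integral_distr) auto
  also have "\<dots> = (\<integral>x. \<integral>t. h (x, t) \<partial>distr M T Y \<partial>distr M S X)"
    unfolding D(1) using i by (rule P.integral_fst'[symmetric])
  also have "\<dots> = (\<integral>w. (\<integral>t. h (X w, t) \<partial>distr M T Y) \<partial>M)"
    by (subst integral_distr) measurable
  finally show ?thesis .
qed

text \<open>The \<open>ennreal\<close> counterpart presupposes no integrability, so it can be used
  to establish finiteness of moments.\<close>

lemma indep_pair_nn_integral: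
  assumes ind: "indep_pair S X T Y"
    and [measurable]: "h \<in> borel_measurable (S \<Otimes>\<^sub>M T)"
  shows "(\<integral>\<^sup>+w. h (X w, Y w) \<partial>M) = (\<integral>\<^sup>+w. (\<integral>\<^sup>+t. h (X w, t) \<partial>distr M T Y) \<partial>M)"
proof -
  note D = indep_pairD[OF ind]
  note [measurable] = D(2,3)
  interpret Y: prob_space "distr M T Y" by (rule prob_space_distr) (rule D)
  have "(\<integral>\<^sup>+w. h (X w, Y w) \<partial>M) = integral\<^sup>N (distr M (S \<Otimes>\<^sub>M T) (\<lambda>w. (X w, Y w))) h"
    by (subst nn_integral_distr) auto
  also have "\<dots> = (\<integral>\<^sup>+x. \<integral>\<^sup>+t. h (x, t) \<partial>distr M T Y \<partial>distr M S X)"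
    unfolding D(1) by (rule Y.nn_integral_fst[symmetric]) measurable
  also have "\<dots> = (\<integral>\<^sup>+w. (\<integral>\<^sup>+t. h (X w, t) \<partial>distr M T Y) \<partial>M)"
    by (subst nn_integral_distr) measurable
  finally show ?thesis .
qed

text \<open>Disjoint groups of independent Int-stable families generate independent sigma-algebras.
  These are encoded by the identity map into \<open>?A\<close> and into \<open>?B\<close>, which
  share a value type; pushing the product law forward along \<open>X\<close> and \<open>Y\<close>
  then reaches arbitrary target types.\<close>

lemma indep_pair_of_disjoint_sources:
  assumes indep: "indep_sets E I" and stable: "\<And>i. i \<in> I \<Longrightarrow> Int_stable (E i)"
    and AB: "A \<inter> B = {}" "A \<subseteq> I" "B \<subseteq> I"
    and X: "X \<in> sigma (space M) (\<Union>i\<in>A. E i) \<rightarrow>\<^sub>M S"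
    and Y: "Y \<in> sigma (space M) (\<Union>i\<in>B. E i) \<rightarrow>\<^sub>M T"
  shows "indep_pair S X T Y"
proof -
  have E: "i \<in> I \<Longrightarrow> E i \<subseteq> events" for i using indep by (auto simp: indep_sets_def)
  have sub: "(\<Union>i\<in>A. E i) \<subseteq> events" "(\<Union>i\<in>B. E i) \<subseteq> events" using AB E by blast+
  then have pow: "(\<Union>i\<in>A. E i) \<subseteq> Pow (space M)" "(\<Union>i\<in>B. E i) \<subseteq> Pow (space M)"
    using sets.space_closed by blast+
  have ev: "sigma_sets (space M) (\<Union>i\<in>A. E i) \<subseteq> events" "sigma_sets (space M) (\<Union>i\<in>B. E i) \<subseteq> events"
    by (intro sets.sigma_sets_subset sub)+
  let ?A = "sigma (space M) (\<Union>i\<in>A. E i)" and ?B = "sigma (space M) (\<Union>i\<in>B. E i)"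
  have "indep_sets (\<lambda>j. sigma_sets (space M) (\<Union>i\<in>case_bool A B j. E i)) UNIV"
  proof (rule indep_sets_collect_sigma)
    show "indep_sets E (\<Union>j. case_bool A B j)"
      using AB by (intro indep_sets_mono_index[OF _ indep]) (auto split: bool.splits)
    show "disjoint_family_on (case_bool A B) UNIV"
      using AB by (auto simp: disjoint_family_on_def split: bool.splits)
    fix i j assume "i \<in> case_bool A B j"
    then show "Int_stable (E i)" using AB by (intro stable) (auto split: bool.splits)
  qed
  moreover have "{(\<lambda>w. w) -` C \<inter> space M |C. C \<in> sets ?A} \<subseteq> sigma_sets (space M) (\<Union>i\<in>A. E i)"
    "{(\<lambda>w. w) -` C \<inter> space M |C. C \<in> sets ?B} \<subseteq> sigma_sets (space M) (\<Union>i\<in>B. E i)"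
    using pow by (auto simp: sigma_sets_into_sp Int_absorb2)
  ultimately have "indep_set (sigma_sets (space M) {(\<lambda>w. w) -` C \<inter> space M |C. C \<in> sets ?A})
      (sigma_sets (space M) {(\<lambda>w. w) -` C \<inter> space M |C. C \<in> sets ?B})"
    unfolding indep_set_def
    by (elim indep_sets_mono_sets) (auto split: bool.split dest: sigma_sets_mono)
  moreover have id: "(\<lambda>w. w) \<in> M \<rightarrow>\<^sub>M ?A" "(\<lambda>w. w) \<in> M \<rightarrow>\<^sub>M ?B"
    using pow ev by (auto simp: measurable_def sigma_sets_into_sp Int_absorb2)
  ultimately have "indep_var ?A (\<lambda>w. w) ?B (\<lambda>w. w)" by (simp add: indep_var_eq)
  then have prod: "distr M ?A (\<lambda>w. w) \<Otimes>\<^sub>M distr M ?B (\<lambda>w. w) = distr M (?A \<Otimes>\<^sub>M ?B) (\<lambda>w. (w, w))"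
    by (simp add: indep_var_distribution_eq)
  have XY: "X \<in> M \<rightarrow>\<^sub>M S" "Y \<in> M \<rightarrow>\<^sub>M T"
    using measurable_compose[OF id(1) X] measurable_compose[OF id(2) Y] by simp_all
  interpret Y: prob_space "distr M T Y" by (rule prob_space_distr) (rule XY)
  have "distr M S X \<Otimes>\<^sub>M distr M T Y
      = distr (distr M ?A (\<lambda>w. w)) S X \<Otimes>\<^sub>M distr (distr M ?B (\<lambda>w. w)) T Y"
    using X Y id by (simp add: distr_distr comp_def)
  also have "\<dots> = distr (distr M ?A (\<lambda>w. w) \<Otimes>\<^sub>M distr M ?B (\<lambda>w. w)) (S \<Otimes>\<^sub>M T) (\<lambda>(v, w). (X v, Y w))"
  proof (rule pair_measure_distr)
    have "distr (distr M ?B (\<lambda>w. w)) T Y = distr M T Y"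
      using Y id by (simp add: distr_distr comp_def)
    then show "sigma_finite_measure (distr (distr M ?B (\<lambda>w. w)) T Y)"
      using Y.sigma_finite_measure_axioms by simp
  qed (use X Y in simp_all)
  also have "\<dots> = distr M (S \<Otimes>\<^sub>M T) (\<lambda>w. (X w, Y w))"
  proof -
    have "(\<lambda>(v, w). (X v, Y w)) \<in> ?A \<Otimes>\<^sub>M ?B \<rightarrow>\<^sub>M S \<Otimes>\<^sub>M T"
      using X Y by measurable
    then show ?thesis using id by (simp add: prod distr_distr comp_def)
  qed
  finally show ?thesis using XY by (simp add: indep_pair_def)
qed

text \<open>Sets of the conditioning algebra are preimages under \<open>X\<close>, so their
  indicators can be frozen along with \<open>X\<close>. The characteristic property of the
  conditional expectation thereby reduces to \<open>indep_pair_integral\<close>.\<close>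

lemma real_cond_exp_indep_pair:
  fixes h :: "_ \<Rightarrow> real"
  assumes ind: "indep_pair S X T Y"
    and h [measurable]: "h \<in> borel_measurable (S \<Otimes>\<^sub>M T)"
    and int: "integrable M (\<lambda>w. h (X w, Y w))"
  shows "AE w in M. real_cond_exp M (vimage_algebra (space M) X S) (\<lambda>w. h (X w, Y w)) w
    = (\<integral>t. h (X w, t) \<partial>distr M T Y)"
proof -
  let ?F = "vimage_algebra (space M) X S"
  note D = indep_pairD[OF ind]
  note [measurable] = D(2,3)
  have sp: "X \<in> space M \<rightarrow> space S" using D(2) by (rule measurable_space[THEN funcsetI])
  have XF [measurable]: "X \<in> ?F \<rightarrow>\<^sub>M S" using sp by (rule measurable_vimage_algebra1)
  have sub: "subalgebra M ?F"
    unfolding subalgebra_def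
    using D(2) sp by (auto simp: sets_vimage_algebra2 dest: measurable_sets)
  interpret F: finite_measure_subalgebra M ?F
    by unfold_locales (rule sub)
  interpret X: prob_space "distr M S X" by (rule prob_space_distr) (rule D)
  interpret Y: prob_space "distr M T Y" by (rule prob_space_distr) (rule D)
  interpret P: pair_sigma_finite "distr M S X" "distr M T Y" ..
  have i: "integrable (distr M S X \<Otimes>\<^sub>M distr M T Y) h"
    using int by (subst D(1)[symmetric], subst integrable_distr_eq) auto
  show ?thesis
  proof (rule F.real_cond_exp_charact)
    show "integrable M (\<lambda>w. \<integral>t. h (X w, t) \<partial>distr M T Y)"
      using P.integrable_fst'[OF i] by (subst (asm) integrable_distr_eq) measurable
    show "(\<lambda>w. \<integral>t. h (X w, t) \<partial>distr M T Y) \<in> borel_measurable ?F" by measurable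
    fix A assume "A \<in> sets ?F"
    then obtain C where C [measurable]: "C \<in> sets S" and A: "A = X -` C \<inter> space M"
      using sp by (auto simp: sets_vimage_algebra2)
    have "(\<integral>w\<in>A. h (X w, Y w) \<partial>M) = (\<integral>w. indicator C (X w) * h (X w, Y w) \<partial>M)"
      unfolding set_lebesgue_integral_def A
      by (rule Bochner_Integration.integral_cong) (auto simp: indicator_def)
    also have "\<dots> = (\<integral>w. (\<integral>t. indicator C (X w) * h (X w, t) \<partial>distr M T Y) \<partial>M)"
    proof -
      have "integrable M (\<lambda>w. indicator C (X w) * h (X w, Y w))"
        by (rule Bochner_Integration.integrable_bound[OF int]) (auto simp: indicator_def)
      then show ?thesis
        using indep_pair_integral[OF ind, of "\<lambda>z. indicator C (fst z) * h z"] by simp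
    qed
    also have "\<dots> = (\<integral>w\<in>A. (\<integral>t. h (X w, t) \<partial>distr M T Y) \<partial>M)"
      unfolding set_lebesgue_integral_def A
      by (rule Bochner_Integration.integral_cong) (auto simp: indicator_def)
    finally show "(\<integral>w\<in>A. h (X w, Y w) \<partial>M) = (\<integral>w\<in>A. (\<integral>t. h (X w, t) \<partial>distr M T Y) \<partial>M)" .
  qed (rule int)
qed

end


text \<open>Moments are first bounded in \<open>ennreal\<close>, where finiteness need not be known;
  this brings integrability and the bound back to the reals together.\<close>

lemma integrable_if_nn_integral_le:
  fixes f :: "'w \<Rightarrow> real"
  assumes "f \<in> borel_measurable M" "\<And>w. 0 \<le> f w" "0 \<le> r"
    and le: "(\<integral>\<^sup>+w. ennreal (f w) \<partial>M) \<le> ennreal r"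
  shows "integrable M f" "(\<integral>w. f w \<partial>M) \<le> r"
proof -
  show "integrable M f"
    using assms le_less_trans[OF le] by (intro integrableI_bounded) auto
  show "(\<integral>w. f w \<partial>M) \<le> r"
    using assms by (subst integral_eq_nn_integral) (auto intro: enn2real_leI)
qed

text \<open>On a finite \<open>count_space\<close> every function is measurable and bounded, so
  functions of a minibatch can be integrated without side conditions.\<close>

lemma (in prob_space) integrable_distr_finite_count_space:
  fixes h :: "'b \<Rightarrow> 'c::{banach, second_countable_topology}"
  assumes "finite B" "Y \<in> M \<rightarrow>\<^sub>M count_space B"
  shows "integrable (distr M (count_space B) Y) h"
proof -
  interpret Y: prob_space "distr M (count_space B) Y" by (rule prob_space_distr) (rule assms)
  show ?thesis
  proof (rule Y.integrable_const_bound[where B = "\<Sum>t\<in>B. norm (h t)"])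
    show "AE t in distr M (count_space B) Y. norm (h t) \<le> (\<Sum>t\<in>B. norm (h t))"
      using assms(1) by (intro AE_I2) (auto intro: member_le_sum)
  qed simp
qed

lemma generated_Pow: "generated M N X \<subseteq> Pow (space M)"
  unfolding generated_def using sets.space_closed[of "vimage_algebra (space M) X N"] by simp

section \<open>The error of the gradient estimator\<close>

locale vr_marina_run =
  fixes fs :: "nat \<Rightarrow> nat \<Rightarrow> real ^ 'd \<Rightarrow> real"
    and Q :: "'u \<Rightarrow> real ^ 'd \<Rightarrow> real ^ 'd" and U :: "'u measure"
    and M :: "'w measure"
    and c :: "nat \<Rightarrow> 'w \<Rightarrow> bool" and J :: "nat \<Rightarrow> nat \<Rightarrow> 'w \<Rightarrow> nat set"
    and s :: "nat \<Rightarrow> nat \<Rightarrow> 'w \<Rightarrow> 'u" and \<tau> :: "nat \<Rightarrow> 'w \<Rightarrow> nat"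
    and x g :: "nat \<Rightarrow> 'w \<Rightarrow> real ^ 'd" and x0 :: "real ^ 'd"
    and n m b :: nat and Ls \<L>s :: "nat \<Rightarrow> real"
    and \<omega> p \<gamma> :: real
  assumes n: "1 \<le> n" and b: "1 \<le> b" "b \<le> m"
    and differentiable: "\<And>i j y. i \<in> {1..n} \<Longrightarrow> j \<in> {1..m} \<Longrightarrow> fs i j differentiable (at y)"
    and smooth: "\<And>i. i \<in> {1..n} \<Longrightarrow>
                   (Ls i)-lipschitz_on UNIV (gradient (local_loss fs m i))"
    and quantization: "quantization U Q \<omega>"
    and p01: "0 \<le> p" "p \<le> 1"
    and sampling: "sampling M U n m b p c J s \<tau>"
    and vr_marina: "vr_marina M fs n m b Q \<gamma> x0 c J s x g"
    and average_smooth: "average_smooth M fs n m b J x \<L>s"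
    and \<gamma>: "0 < \<gamma>"
begin

abbreviation "f \<equiv> global_loss fs n m"
abbreviation "G i \<equiv> gradient (local_loss fs m i)"
abbreviation "batches \<equiv> {S. S \<subseteq> {1..m} \<and> card S = b}"

definition diff :: "nat \<Rightarrow> nat \<Rightarrow> 'w \<Rightarrow> real ^ 'd" where
  "diff i k w = G i (x (Suc k) w) - G i (x k w)"

definition batch_diff :: "nat \<Rightarrow> nat \<Rightarrow> 'w \<Rightarrow> real ^ 'd" where
  "batch_diff i k w = minibatch_diff fs b i (J i k w) (x k w) (x (Suc k) w)"

definition message :: "nat \<Rightarrow> nat \<Rightarrow> 'w \<Rightarrow> real ^ 'd" where
  "message i k w = Q (s i k w) (batch_diff i k w)"

section \<open>Information carried by the random sources\<close>

definition source_sets :: "nat \<Rightarrow> source \<Rightarrow> 'w set set" where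
  "source_sets K src = (case src of
      Coin k \<Rightarrow> generated M (count_space UNIV) (c k)
    | Minibatch i k \<Rightarrow> generated M (count_space batches) (J i k)
    | Seed i k \<Rightarrow> generated M U (s i k)
    | Output \<Rightarrow> generated M (count_space UNIV) (\<tau> K))"

text \<open>The events determined by the sources in \<open>A\<close>. The parameter \<open>K\<close>
  only fixes which returned index the source \<open>Output\<close> stands for.\<close>

definition info :: "nat \<Rightarrow> source set \<Rightarrow> 'w measure" where
  "info K A = sigma (space M) (\<Union>src\<in>A. source_sets K src)"

text \<open>The sources read by the iterates of index \<open>k\<close>. The inequality is strict
  because iteration \<open>j\<close> produces the estimator of index \<open>Suc j\<close>; the
  returned index influences no iterate.\<close>

definition past :: "nat \<Rightarrow> source set" where
  "past k = {src \<in> sources n. case src of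
      Coin j \<Rightarrow> j < k | Minibatch i j \<Rightarrow> j < k | Seed i j \<Rightarrow> j < k | Output \<Rightarrow> False}"

sublocale prob_space M
  using sampling by (simp add: sampling_def)

sublocale U: prob_space U
  using quantization by (simp add: quantization_def)

lemma rv:
  "c k \<in> M \<rightarrow>\<^sub>M count_space UNIV"
  "i \<in> {1..n} \<Longrightarrow> J i k \<in> M \<rightarrow>\<^sub>M count_space batches"
  "i \<in> {1..n} \<Longrightarrow> s i k \<in> M \<rightarrow>\<^sub>M U"
  "1 \<le> K \<Longrightarrow> \<tau> K \<in> M \<rightarrow>\<^sub>M count_space UNIV"
  using sampling by (auto simp: sampling_def)

lemma distr_seed: "i \<in> {1..n} \<Longrightarrow> distr M U (s i k) = U"
  using sampling by (auto simp: sampling_def)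

lemma source_sets_Pow: "source_sets K src \<subseteq> Pow (space M)"
  unfolding source_sets_def by (cases src) (simp_all add: generated_Pow)

lemma space_info [simp]: "space (info K A) = space M"
  unfolding info_def using source_sets_Pow by (intro space_measure_of) auto

lemma sets_info: "sets (info K A) = sigma_sets (space M) (\<Union>src\<in>A. source_sets K src)"
  unfolding info_def using source_sets_Pow by (intro sets_measure_of) auto

lemma generated_imp_measurable_info:
  assumes "generated M N X \<subseteq> sets (info K A)" "X \<in> M \<rightarrow>\<^sub>M N"
  shows "X \<in> info K A \<rightarrow>\<^sub>M N"
  using assms measurable_space[OF assms(2)] in_vimage_algebra[of _ N X "space M"]
  unfolding generated_def by (intro measurableI) auto

lemma measurable_info:
  "Coin k \<in> A \<Longrightarrow> c k \<in> info K A \<rightarrow>\<^sub>M count_space UNIV"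
  "Minibatch i k \<in> A \<Longrightarrow> i \<in> {1..n} \<Longrightarrow> J i k \<in> info K A \<rightarrow>\<^sub>M count_space batches"
  "Seed i k \<in> A \<Longrightarrow> i \<in> {1..n} \<Longrightarrow> s i k \<in> info K A \<rightarrow>\<^sub>M U"
  "Output \<in> A \<Longrightarrow> 1 \<le> K \<Longrightarrow> \<tau> K \<in> info K A \<rightarrow>\<^sub>M count_space UNIV"
proof -
  have sub: "src \<in> A \<Longrightarrow> source_sets K src \<subseteq> sets (info K A)" for src
    by (auto simp: sets_info)
  show "Coin k \<in> A \<Longrightarrow> c k \<in> info K A \<rightarrow>\<^sub>M count_space UNIV"
    using sub[of "Coin k"] by (intro generated_imp_measurable_info rv) (simp add: source_sets_def)
  show "Minibatch i k \<in> A \<Longrightarrow> i \<in> {1..n} \<Longrightarrow> J i k \<in> info K A \<rightarrow>\<^sub>M count_space batches"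
    using sub[of "Minibatch i k"]
    by (intro generated_imp_measurable_info rv) (simp_all add: source_sets_def)
  show "Seed i k \<in> A \<Longrightarrow> i \<in> {1..n} \<Longrightarrow> s i k \<in> info K A \<rightarrow>\<^sub>M U"
    using sub[of "Seed i k"]
    by (intro generated_imp_measurable_info rv) (simp_all add: source_sets_def)
  show "Output \<in> A \<Longrightarrow> 1 \<le> K \<Longrightarrow> \<tau> K \<in> info K A \<rightarrow>\<^sub>M count_space UNIV"
    using sub[of Output]
    by (intro generated_imp_measurable_info rv) (simp_all add: source_sets_def)
qed

lemma measurable_info_mono:
  assumes "A \<subseteq> B" "X \<in> info K A \<rightarrow>\<^sub>M N"
  shows "X \<in> info K B \<rightarrow>\<^sub>M N"
proof -
  have "sets (info K A) \<subseteq> sets (info K B)"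
    unfolding sets_info using assms(1) by (intro sigma_sets_mono') auto
  then show ?thesis using assms(2) by (auto simp: measurable_def)
qed

lemma indep_sources:
  assumes "1 \<le> K"
  shows "indep_sets (source_sets K) (sources n)"
  using sampling assms unfolding sampling_def source_sets_def[abs_def] by auto

lemma measurable_info_imp:
  assumes "1 \<le> K" "A \<subseteq> sources n" "X \<in> info K A \<rightarrow>\<^sub>M N"
  shows "X \<in> M \<rightarrow>\<^sub>M N"
proof -
  have "sets (info K A) \<subseteq> events"
    unfolding sets_info using indep_sources[OF assms(1)] assms(2)
    by (intro sets.sigma_sets_subset) (auto simp: indep_sets_def)
  then show ?thesis using assms(3) by (auto simp: measurable_def)
qed

text \<open>The form in which independence is used below: name the sources that each variable reads
  and check that the two sets are disjoint. Every \<open>source_sets K src\<close> is Int-stable,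
  being a sigma-algebra.\<close>

lemma indep_pair_info:
  assumes "1 \<le> K" "A \<inter> B = {}" "A \<subseteq> sources n" "B \<subseteq> sources n"
    and "X \<in> info K A \<rightarrow>\<^sub>M S" "Y \<in> info K B \<rightarrow>\<^sub>M T"
  shows "indep_pair S X T Y"
proof (rule indep_pair_of_disjoint_sources[OF indep_sources[OF assms(1)] _ assms(2-4)])
  show "Int_stable (source_sets K src)" for src
    unfolding source_sets_def generated_def
    by (cases src) (auto simp: Int_stable_def)
qed (use assms(5,6) in \<open>simp_all add: info_def\<close>)

lemma past_sources: "past k \<subseteq> sources n"
  by (auto simp: past_def)

lemma past_Suc: "past k \<subseteq> past (Suc k)"
  by (auto simp: past_def split: source.splits)

lemma sourcesI:
  "Output \<in> sources n" "Coin k \<in> sources n"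
  "i \<in> {1..n} \<Longrightarrow> Minibatch i k \<in> sources n" "i \<in> {1..n} \<Longrightarrow> Seed i k \<in> sources n"
  by (auto simp: sources_def)

lemma past_mem:
  "Output \<notin> past k" "Coin j \<in> past k \<longleftrightarrow> j < k"
  "Minibatch i j \<in> past k \<longleftrightarrow> j < k \<and> i \<in> {1..n}" "Seed i j \<in> past k \<longleftrightarrow> j < k \<and> i \<in> {1..n}"
  by (auto simp: past_def sources_def)

section \<open>Measurability of the iterates\<close>

lemma run:
  assumes "w \<in> space M"
  shows "x 0 w = x0" "g 0 w = gradient f x0" "x (Suc k) w = x k w - \<gamma> *\<^sub>R g k w"
    "g (Suc k) w = (1 / real n) *\<^sub>R
      (\<Sum>i=1..n. if c k w then G i (x (Suc k) w) else g k w + message i k w)"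
  using vr_marina assms unfolding vr_marina_def message_def batch_diff_def by auto

lemma G_lipschitz: "i \<in> {1..n} \<Longrightarrow> norm (G i y - G i z) \<le> Ls i * norm (y - z)"
  using lipschitz_onD[OF smooth, of i y z] by (simp add: dist_norm)

lemma measurable_G [measurable]: "i \<in> {1..n} \<Longrightarrow> G i \<in> borel_measurable borel"
  by (intro borel_measurable_continuous_onI lipschitz_on_continuous_on[OF smooth])

lemma gradient_f: "gradient f y = (1 / real n) *\<^sub>R (\<Sum>i=1..n. G i y)"
  using differentiable by (rule gradient_global_loss)

lemma measurable_gradient_f [measurable]: "gradient f \<in> borel_measurable borel"
  unfolding gradient_f[abs_def] by measurable

lemma measurable_Q [measurable (raw)]:
  "X \<in> N \<rightarrow>\<^sub>M U \<Longrightarrow> Y \<in> N \<rightarrow>\<^sub>M borel \<Longrightarrow> (\<lambda>w. Q (X w) (Y w)) \<in> N \<rightarrow>\<^sub>M borel"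
  using measurable_compose[OF _ quantization_measurable(1)[OF quantization], of "\<lambda>w. (X w, Y w)"]
  by simp

lemma finite_batches: "finite batches" by simp

text \<open>A minibatch takes only finitely many values, so measurability can be checked with the
  batch held fixed at \<open>T\<close>.\<close>

lemma measurable_minibatch_diff:
  assumes i: "i \<in> {1..n}" and [measurable]: "X \<in> N \<rightarrow>\<^sub>M borel" "Y \<in> N \<rightarrow>\<^sub>M borel"
    and S: "S \<in> N \<rightarrow>\<^sub>M count_space batches"
  shows "(\<lambda>w. minibatch_diff fs b i (S w) (X w) (Y w)) \<in> N \<rightarrow>\<^sub>M borel"
proof (rule measurable_compose_countable'[OF _ S])
  fix T assume T: "T \<in> batches"
  have [measurable]: "j \<in> T \<Longrightarrow> gradient (fs i j) \<in> borel_measurable borel" for j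
    using T i by (intro borel_measurable_gradient differentiable) auto
  show "(\<lambda>w. minibatch_diff fs b i T (X w) (Y w)) \<in> N \<rightarrow>\<^sub>M borel"
    unfolding minibatch_diff_def by measurable
qed (simp add: countable_finite)

lemma measurable_diff:
  assumes "i \<in> {1..n}" "x k \<in> N \<rightarrow>\<^sub>M borel" "x (Suc k) \<in> N \<rightarrow>\<^sub>M borel"
  shows "diff i k \<in> N \<rightarrow>\<^sub>M borel"
proof -
  note [measurable] = assms measurable_G[OF assms(1)]
  show ?thesis unfolding diff_def[abs_def] by measurable
qed

lemma measurable_batch_diff:
  assumes "i \<in> {1..n}" "x k \<in> N \<rightarrow>\<^sub>M borel" "x (Suc k) \<in> N \<rightarrow>\<^sub>M borel"
    "J i k \<in> N \<rightarrow>\<^sub>M count_space batches"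
  shows "batch_diff i k \<in> N \<rightarrow>\<^sub>M borel"
  unfolding batch_diff_def[abs_def] using assms by (rule measurable_minibatch_diff)

lemma measurable_message:
  assumes "i \<in> {1..n}" "x k \<in> N \<rightarrow>\<^sub>M borel" "x (Suc k) \<in> N \<rightarrow>\<^sub>M borel"
    "J i k \<in> N \<rightarrow>\<^sub>M count_space batches" "s i k \<in> N \<rightarrow>\<^sub>M U"
  shows "message i k \<in> N \<rightarrow>\<^sub>M borel"
proof -
  note [measurable] = measurable_batch_diff[OF assms(1-4)] assms(5)
  show ?thesis unfolding message_def[abs_def] by measurable
qed

lemma measurable_x_Suc:
  assumes "x k \<in> N \<rightarrow>\<^sub>M borel" "g k \<in> N \<rightarrow>\<^sub>M borel" "space N = space M"
  shows "x (Suc k) \<in> N \<rightarrow>\<^sub>M borel"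
proof -
  note [measurable] = assms(1,2)
  have "(\<lambda>w. x k w - \<gamma> *\<^sub>R g k w) \<in> N \<rightarrow>\<^sub>M borel" by measurable
  then show ?thesis using assms(3) run(3) by (subst measurable_cong) auto
qed

text \<open>By induction: iteration \<open>k\<close> adds the coin, the minibatches and the seeds of
  index \<open>k\<close>, all of which belong to \<open>past (Suc k)\<close>.\<close>

lemma measurable_xg_past: "x k \<in> info K (past k) \<rightarrow>\<^sub>M borel \<and> g k \<in> info K (past k) \<rightarrow>\<^sub>M borel"
proof (induction k)
  case 0
  have "x 0 \<in> info K A \<rightarrow>\<^sub>M borel" for A
    using run(1) by (subst measurable_cong[where g = "\<lambda>_. x0"]) auto
  moreover have "g 0 \<in> info K A \<rightarrow>\<^sub>M borel" for A
    using run(2) by (subst measurable_cong[where g = "\<lambda>_. gradient f x0"]) auto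
  ultimately show ?case by blast
next
  case (Suc k)
  let ?N = "info K (past (Suc k))"
  have xg [measurable]: "x k \<in> ?N \<rightarrow>\<^sub>M borel" "g k \<in> ?N \<rightarrow>\<^sub>M borel"
    using Suc measurable_info_mono[OF past_Suc] by blast+
  then have x' [measurable]: "x (Suc k) \<in> ?N \<rightarrow>\<^sub>M borel" by (rule measurable_x_Suc) simp
  have [measurable]: "i \<in> {1..n} \<Longrightarrow> message i k \<in> ?N \<rightarrow>\<^sub>M borel" for i
    using xg(1) x' by (intro measurable_message measurable_info) (auto simp: past_mem)
  have [measurable]: "c k \<in> ?N \<rightarrow>\<^sub>M count_space UNIV"
    by (intro measurable_info) (simp add: past_mem)
  have "(\<lambda>w. (1 / real n) *\<^sub>R
      (\<Sum>i=1..n. if c k w then G i (x (Suc k) w) else g k w + message i k w)) \<in> ?N \<rightarrow>\<^sub>M borel"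
    by measurable
  then have "g (Suc k) \<in> ?N \<rightarrow>\<^sub>M borel"
    using run(4) by (subst measurable_cong) auto
  with x' show ?case by blast
qed

text \<open>\<open>x (Suc k)\<close> is already determined by \<open>past k\<close>, because the
  step uses only \<open>x k\<close> and \<open>g k\<close>. Hence both end points of the step are
  fixed before the coin, minibatches and seeds of iteration \<open>k\<close> come in.\<close>

lemma measurable_past:
  assumes "past k \<subseteq> A"
  shows "x k \<in> info K A \<rightarrow>\<^sub>M borel" "g k \<in> info K A \<rightarrow>\<^sub>M borel" "x (Suc k) \<in> info K A \<rightarrow>\<^sub>M borel"
proof -
  show *: "x k \<in> info K A \<rightarrow>\<^sub>M borel" "g k \<in> info K A \<rightarrow>\<^sub>M borel"
    using measurable_xg_past measurable_info_mono[OF assms] by blast+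
  from * show "x (Suc k) \<in> info K A \<rightarrow>\<^sub>M borel" by (rule measurable_x_Suc) simp
qed

lemma measurable_M [measurable]:
  "x k \<in> M \<rightarrow>\<^sub>M borel" "g k \<in> M \<rightarrow>\<^sub>M borel"
  "i \<in> {1..n} \<Longrightarrow> diff i k \<in> M \<rightarrow>\<^sub>M borel"
  "i \<in> {1..n} \<Longrightarrow> batch_diff i k \<in> M \<rightarrow>\<^sub>M borel"
  "i \<in> {1..n} \<Longrightarrow> message i k \<in> M \<rightarrow>\<^sub>M borel"
proof -
  show x: "x k \<in> M \<rightarrow>\<^sub>M borel" and "g k \<in> M \<rightarrow>\<^sub>M borel" for k
    using measurable_past[OF subset_refl] measurable_info_imp[OF le_refl past_sources] by blast+
  show "i \<in> {1..n} \<Longrightarrow> diff i k \<in> M \<rightarrow>\<^sub>M borel"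
    "i \<in> {1..n} \<Longrightarrow> batch_diff i k \<in> M \<rightarrow>\<^sub>M borel"
    "i \<in> {1..n} \<Longrightarrow> message i k \<in> M \<rightarrow>\<^sub>M borel"
    by (intro measurable_diff measurable_batch_diff measurable_message x rv; assumption)+
qed

end


section \<open>Second moment of the estimation error\<close>

context vr_marina_run
begin

abbreviation "step k w \<equiv> x (Suc k) w - x k w"

definition err :: "nat \<Rightarrow> 'w \<Rightarrow> real ^ 'd" where
  "err k w = g k w - gradient f (x k w)"

abbreviation "state_info k \<equiv> vimage_algebra (space M) (\<lambda>w. (x k w, x (Suc k) w)) borel"

lemma indep_pair_batch_diff_seed:
  assumes i: "i \<in> {1..n}"
  shows "indep_pair borel (batch_diff i k) U (s i k)"
proof (rule indep_pair_info[of 1 "past k \<union> {Minibatch i k}" "{Seed i k}"])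
  show "batch_diff i k \<in> info 1 (past k \<union> {Minibatch i k}) \<rightarrow>\<^sub>M borel"
    using i by (intro measurable_batch_diff measurable_past measurable_info) auto
  show "s i k \<in> info 1 {Seed i k} \<rightarrow>\<^sub>M U" using i by (intro measurable_info) auto
qed (use i past_sources in \<open>auto simp: past_mem sourcesI\<close>)

lemma average_smoothD:
  assumes "i \<in> {1..n}"
  shows "0 \<le> \<L>s i"
    "AE w in M. real_cond_exp M (state_info k) (\<lambda>w. batch_diff i k w $ l) w = diff i k w $ l"
    "AE w in M. nn_cond_exp M (state_info k) (\<lambda>w. ennreal ((norm (batch_diff i k w - diff i k w))\<^sup>2)) w
       \<le> ennreal ((\<L>s i)\<^sup>2 / real b * (norm (step k w))\<^sup>2)"
  using average_smooth assms
  unfolding average_smooth_def Let_def diff_def[symmetric] batch_diff_def[symmetric] by auto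

lemma subalgebra_state_info: "subalgebra M (state_info k)"
proof -
  have V: "(\<lambda>w. (x k w, x (Suc k) w)) \<in> M \<rightarrow>\<^sub>M borel" by measurable
  show ?thesis
    unfolding subalgebra_def using measurable_sets[OF V]
    by (auto simp: sets_vimage_algebra2)
qed

text \<open>A \<open>True\<close> coin makes the estimator the exact gradient. Otherwise the
  estimator moves by the average message while the gradient moves by the average of
  \<open>diff i k\<close>, and the error accumulates the discrepancy.\<close>

lemma err_Suc:
  assumes "w \<in> space M"
  shows "err (Suc k) w =
    (if c k w then 0 else err k w + (1 / real n) *\<^sub>R (\<Sum>i=1..n. message i k w - diff i k w))"
proof (cases "c k w")
  case True
  then show ?thesis using run(4)[OF assms, of k] by (simp add: err_def gradient_f)
next
  case False
  have "(1 / real n) *\<^sub>R (\<Sum>i=1..n. g k w + message i k w)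
      = g k w + (1 / real n) *\<^sub>R (\<Sum>i=1..n. message i k w)"
    using n by (simp add: sum.distrib scaleR_add_right sum_constant_scaleR del: sum_constant)
  then show ?thesis using run(4)[OF assms, of k] False
    by (simp add: err_def gradient_f diff_def sum_subtractf sum.distrib algebra_simps)
qed

lemma square_integrable_G:
  assumes "i \<in> {1..n}" "square_integrable M X"
  shows "square_integrable M (\<lambda>w. G i (X w))"
  using finite_measure_axioms assms(2) measurable_G[OF assms(1)] G_lipschitz[OF assms(1)]
  by (rule square_integrable_lipschitz)

lemma square_integrable_gradient_f:
  assumes "square_integrable M X"
  shows "square_integrable M (\<lambda>w. gradient f (X w))"
  unfolding gradient_f
  by (intro square_integrable_scaleR square_integrable_sum square_integrable_G assms finite_measure_axioms)

lemma coin_prob: "measure M {w \<in> space M. \<not> c k w} = 1 - p" "measure M {w \<in> space M. c k w} = p"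
proof -
  have D: "distr M (count_space UNIV) (c k) = measure_pmf (bernoulli_pmf p)"
    using sampling by (simp add: sampling_def)
  have "measure M {w \<in> space M. c k w = v} = pmf (bernoulli_pmf p) v" for v
  proof -
    have "measure M {w \<in> space M. c k w = v} = measure (distr M (count_space UNIV) (c k)) {v}"
      by (subst measure_distr) (auto simp: rv intro!: arg_cong[where f = "measure M"])
    then show ?thesis by (simp add: D measure_pmf_single)
  qed
  from this[of False] this[of True]
  show "measure M {w \<in> space M. \<not> c k w} = 1 - p" "measure M {w \<in> space M. c k w} = p"
    using p01 by simp_all
qed

section \<open>One iteration starting from square-integrable iterates\<close>

context
  fixes k :: nat
  assumes xk: "square_integrable M (x k)" and gk: "square_integrable M (g k)"
begin

lemma square_integrable_x_Suc: "square_integrable M (x (Suc k))"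
  using square_integrable_diff[OF xk square_integrable_scaleR[OF gk, of \<gamma>]] run(3)
  by (subst square_integrable_cong) auto

lemma square_integrable_step: "square_integrable M (step k)"
  using square_integrable_x_Suc xk by auto

lemma square_integrable_err: "square_integrable M (err k)"
  unfolding err_def[abs_def] using gk square_integrable_gradient_f[OF xk] by auto

text \<open>The conditional bound is integrated over the whole space. Since it is stated with
  \<open>nn_cond_exp\<close>, finiteness of the second moment comes out along with the
  bound.\<close>

lemma square_integrable_minibatch_error:
  assumes i: "i \<in> {1..n}"
  shows "square_integrable M (\<lambda>w. batch_diff i k w - diff i k w)"
    and "(\<integral>w. (norm (batch_diff i k w - diff i k w))\<^sup>2 \<partial>M)
      \<le> (\<L>s i)\<^sup>2 / real b * (\<integral>w. (norm (step k w))\<^sup>2 \<partial>M)"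
proof -
  note [measurable] = measurable_M(3,4)[OF i]
  interpret F: finite_measure_subalgebra M "state_info k"
    by unfold_locales (rule subalgebra_state_info)
  let ?e = "\<lambda>w. ennreal ((norm (batch_diff i k w - diff i k w))\<^sup>2)"
  have int: "integrable M (\<lambda>w. (\<L>s i)\<^sup>2 / real b * (norm (step k w))\<^sup>2)"
    using square_integrable_step by (auto dest: square_integrableD)
  have "(\<integral>\<^sup>+w. ?e w \<partial>M) = (\<integral>\<^sup>+w. nn_cond_exp M (state_info k) ?e w \<partial>M)"
    using F.nn_cond_exp_intg[of "\<lambda>_. 1" ?e] by simp
  also have "\<dots> \<le> (\<integral>\<^sup>+w. ennreal ((\<L>s i)\<^sup>2 / real b * (norm (step k w))\<^sup>2) \<partial>M)"
    by (rule nn_integral_mono_AE) (rule average_smoothD(3)[OF i])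
  also have "\<dots> = ennreal (\<integral>w. (\<L>s i)\<^sup>2 / real b * (norm (step k w))\<^sup>2 \<partial>M)"
    using int by (rule nn_integral_eq_integral) simp
  finally have le: "(\<integral>\<^sup>+w. ?e w \<partial>M) \<le> ennreal ((\<L>s i)\<^sup>2 / real b * (\<integral>w. (norm (step k w))\<^sup>2 \<partial>M))"
    by simp
  show "square_integrable M (\<lambda>w. batch_diff i k w - diff i k w)"
    unfolding square_integrable_def
    using integrable_if_nn_integral_le(1)[OF _ _ _ le] by simp
  show "(\<integral>w. (norm (batch_diff i k w - diff i k w))\<^sup>2 \<partial>M)
      \<le> (\<L>s i)\<^sup>2 / real b * (\<integral>w. (norm (step k w))\<^sup>2 \<partial>M)"
    using integrable_if_nn_integral_le(2)[OF _ _ _ le] by simp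
qed

lemma square_integrable_diff_grad:
  assumes i: "i \<in> {1..n}"
  shows "square_integrable M (diff i k)"
    and "(\<integral>w. (norm (diff i k w))\<^sup>2 \<partial>M) \<le> (Ls i)\<^sup>2 * (\<integral>w. (norm (step k w))\<^sup>2 \<partial>M)"
proof -
  show *: "square_integrable M (diff i k)"
    unfolding diff_def[abs_def]
    by (intro square_integrable_diff square_integrable_G[OF i] xk square_integrable_x_Suc)
  have "(\<integral>w. (norm (diff i k w))\<^sup>2 \<partial>M) \<le> (\<integral>w. (Ls i)\<^sup>2 * (norm (step k w))\<^sup>2 \<partial>M)"
  proof (rule integral_mono)
    fix w
    have "(norm (diff i k w))\<^sup>2 \<le> (Ls i * norm (step k w))\<^sup>2"
      unfolding diff_def using G_lipschitz[OF i] by (intro power_mono) auto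
    then show "(norm (diff i k w))\<^sup>2 \<le> (Ls i)\<^sup>2 * (norm (step k w))\<^sup>2"
      by (simp add: power_mult_distrib)
  qed (use * square_integrable_step in \<open>auto dest: square_integrableD\<close>)
  then show "(\<integral>w. (norm (diff i k w))\<^sup>2 \<partial>M) \<le> (Ls i)\<^sup>2 * (\<integral>w. (norm (step k w))\<^sup>2 \<partial>M)"
    by simp
qed

lemma square_integrable_batch_diff:
  assumes "i \<in> {1..n}"
  shows "square_integrable M (batch_diff i k)"
  using square_integrable_add[OF square_integrable_minibatch_error(1)[OF assms] square_integrable_diff_grad(1)[OF assms]]
  by simp

text \<open>Both points are determined by \<open>past k\<close>, hence independent of the minibatch,
  so the conditional expectation in average smoothness is the integral over the batch law with the
  points frozen. In this form unbiasedness can be reused under larger conditioning.\<close>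

lemma minibatch_mean:
  assumes i: "i \<in> {1..n}"
  shows "AE w in M. (\<integral>S. minibatch_diff fs b i S (x k w) (x (Suc k) w)
    \<partial>distr M (count_space batches) (J i k)) = diff i k w"
proof -
  let ?D = "distr M (count_space batches) (J i k)"
  let ?mb = "\<lambda>S w. minibatch_diff fs b i S (x k w) (x (Suc k) w)"
  have int: "integrable ?D h" for h :: "nat set \<Rightarrow> real ^ 'd"
    by (rule integrable_distr_finite_count_space[OF finite_batches rv(2)[OF i]])
  have "indep_pair borel (\<lambda>w. (x k w, x (Suc k) w)) (count_space batches) (J i k)"
  proof (rule indep_pair_info[of 1 "past k" "{Minibatch i k}"])
    note [measurable] = measurable_past[OF subset_refl]
    show "(\<lambda>w. (x k w, x (Suc k) w)) \<in> info 1 (past k) \<rightarrow>\<^sub>M borel" by measurable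
    show "J i k \<in> info 1 {Minibatch i k} \<rightarrow>\<^sub>M count_space batches"
      using i by (intro measurable_info) auto
  qed (use i past_sources in \<open>auto simp: past_mem sourcesI\<close>)
  note ind = this
  have comp: "AE w in M. (\<integral>S. ?mb S w $ l \<partial>?D) = diff i k w $ l" for l
  proof -
    have "(\<lambda>z. minibatch_diff fs b i (snd z) (fst (fst z)) (snd (fst z)))
        \<in> borel \<Otimes>\<^sub>M count_space batches \<rightarrow>\<^sub>M borel"
      by (rule measurable_minibatch_diff[OF i]) (auto simp: borel_prod[symmetric])
    then have "(\<lambda>z. minibatch_diff fs b i (snd z) (fst (fst z)) (snd (fst z)) $ l)
        \<in> borel_measurable (borel \<Otimes>\<^sub>M count_space batches)"
      by (rule measurable_compose)
        (intro borel_measurable_continuous_onI linear_continuous_on bounded_linear_vec_nth)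
    moreover have "integrable M (\<lambda>w. batch_diff i k w $ l)"
      using integrable_bounded_linear[OF bounded_linear_vec_nth
          square_integrable_integrable[OF finite_measure_axioms square_integrable_batch_diff[OF i]]] .
    ultimately have "AE w in M. real_cond_exp M (state_info k) (\<lambda>w. batch_diff i k w $ l) w
        = (\<integral>S. ?mb S w $ l \<partial>?D)"
      using real_cond_exp_indep_pair[OF ind, of "\<lambda>z. minibatch_diff fs b i (snd z) (fst (fst z)) (snd (fst z)) $ l"]
      by (simp add: batch_diff_def)
    then show ?thesis using average_smoothD(2)[OF i, of k l] by eventually_elim simp
  qed
  \<comment> \<open>There are finitely many components \<open>l\<close>, so one null set serves all
    of them.\<close>
  have "AE w in M. \<forall>l. (\<integral>S. ?mb S w $ l \<partial>?D) = diff i k w $ l"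
    unfolding AE_all_countable using comp by blast
  then show ?thesis
  proof eventually_elim
    case (elim w)
    show ?case
    proof (rule vec_eq_iff[THEN iffD2], rule allI)
      fix l
      show "(\<integral>S. ?mb S w \<partial>?D) $ l = diff i k w $ l"
        using elim integral_bounded_linear[OF bounded_linear_vec_nth[of l] int[of "\<lambda>S. ?mb S w"]] by simp
    qed
  qed
qed

text \<open>Average smoothness conditions on \<open>x\<^sup>k, x\<^sup>k\<^sup>+\<^sup>1\<close> only; since the minibatch is independent of
  the sources in \<open>A\<close>, the conditional mean stays the same when conditioning on all of these.\<close>

lemma minibatch_error_orthogonal:
  assumes i: "i \<in> {1..n}" and A: "past k \<subseteq> A" "A \<subseteq> sources n" "Minibatch i k \<notin> A"
    and B: "B \<in> info 1 A \<rightarrow>\<^sub>M borel" "square_integrable M B"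
  shows "(\<integral>w. B w \<bullet> (batch_diff i k w - diff i k w) \<partial>M) = 0"
proof -
  let ?D = "distr M (count_space batches) (J i k)"
  interpret D: prob_space ?D by (rule prob_space_distr) (rule rv(2)[OF i])
  have int: "integrable ?D h" for h :: "nat set \<Rightarrow> real ^ 'd"
    by (rule integrable_distr_finite_count_space[OF finite_batches rv(2)[OF i]])
  \<comment> \<open>\<open>B\<close> is frozen together with both points, so that only the minibatch
    is averaged and \<open>minibatch_mean\<close> applies inside the outer integral.\<close>
  let ?X = "\<lambda>w. (B w, x k w, x (Suc k) w)"
  let ?e = "\<lambda>v S. minibatch_diff fs b i S (fst v) (snd v) - (G i (snd v) - G i (fst v))"
  let ?h = "\<lambda>z. fst (fst z) \<bullet> ?e (snd (fst z)) (snd z)"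
  have ind: "indep_pair (borel \<Otimes>\<^sub>M borel \<Otimes>\<^sub>M borel) ?X (count_space batches) (J i k)"
  proof (rule indep_pair_info[of 1 A "{Minibatch i k}"])
    note [measurable] = measurable_past[OF A(1)] B(1)
    show "?X \<in> info 1 A \<rightarrow>\<^sub>M borel \<Otimes>\<^sub>M borel \<Otimes>\<^sub>M borel" by measurable
    show "J i k \<in> info 1 {Minibatch i k} \<rightarrow>\<^sub>M count_space batches"
      using i by (intro measurable_info) auto
  qed (use i A in \<open>auto simp: sourcesI\<close>)
  note [measurable] = measurable_G[OF i]
  have [measurable]: "(\<lambda>z. minibatch_diff fs b i (snd z) (fst (snd (fst z))) (snd (snd (fst z))))
      \<in> ((borel :: (real ^ 'd) measure) \<Otimes>\<^sub>M borel \<Otimes>\<^sub>M borel) \<Otimes>\<^sub>M count_space batches \<rightarrow>\<^sub>M borel"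
    by (rule measurable_minibatch_diff[OF i]) auto
  have h: "?h \<in> borel_measurable ((borel \<Otimes>\<^sub>M borel \<Otimes>\<^sub>M borel) \<Otimes>\<^sub>M count_space batches)"
    by measurable
  have "integrable M (\<lambda>w. ?h (?X w, J i k w))"
    using square_integrable_inner[OF B(2) square_integrable_minibatch_error(1)[OF i]]
    by (simp add: batch_diff_def diff_def)
  from indep_pair_integral[OF ind h this]
  have "(\<integral>w. B w \<bullet> (batch_diff i k w - diff i k w) \<partial>M)
      = (\<integral>w. (\<integral>S. B w \<bullet> ?e (x k w, x (Suc k) w) S \<partial>?D) \<partial>M)"
    by (simp add: batch_diff_def diff_def)
  also have "\<dots> = (\<integral>w. 0 \<partial>M)"
  proof (rule integral_cong_AE)
    show "AE w in M. (\<integral>S. B w \<bullet> ?e (x k w, x (Suc k) w) S \<partial>?D) = 0"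
      using minibatch_mean[OF i]
    proof eventually_elim
      case (elim w)
      have "(\<integral>S. B w \<bullet> ?e (x k w, x (Suc k) w) S \<partial>?D)
          = B w \<bullet> (\<integral>S. ?e (x k w, x (Suc k) w) S \<partial>?D)"
        by (rule integral_inner_right) (rule int)
      also have "(\<integral>S. ?e (x k w, x (Suc k) w) S \<partial>?D)
          = (\<integral>S. minibatch_diff fs b i S (x k w) (x (Suc k) w) \<partial>?D) - diff i k w"
        using D.prob_space by (simp add: int diff_def del: One_nat_def)
      finally show ?case by (simp add: elim del: One_nat_def)
    qed
    note [measurable] = square_integrableD(1)[OF B(2)]
    have "(\<lambda>w. (\<integral>S. ?h (?X w, S) \<partial>?D)) \<in> borel_measurable M"
      by (rule D.borel_measurable_lebesgue_integral) measurable
    then show "(\<lambda>w. (\<integral>S. B w \<bullet> ?e (x k w, x (Suc k) w) S \<partial>?D)) \<in> borel_measurable M"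
      by simp
  qed simp
  finally show ?thesis by simp
qed

text \<open>The seed is independent of the quantizer input, so the input can be frozen; the variance
  bound holds at every fixed input and is then integrated.\<close>

lemma square_integrable_quantization_error:
  assumes i: "i \<in> {1..n}"
  shows "square_integrable M (\<lambda>w. message i k w - batch_diff i k w)"
    and "(\<integral>w. (norm (message i k w - batch_diff i k w))\<^sup>2 \<partial>M)
      \<le> \<omega> * (\<integral>w. (norm (batch_diff i k w))\<^sup>2 \<partial>M)"
proof -
  note [measurable] = measurable_M(4,5)[OF i]
  have \<omega>: "0 < \<omega>" using quantization by (simp add: quantization_def)
  note ind = indep_pair_batch_diff_seed[OF i]
  have int: "integrable M (\<lambda>w. \<omega> * (norm (batch_diff i k w))\<^sup>2)"
    using square_integrable_batch_diff[OF i] by (auto dest: square_integrableD)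
  have "(\<integral>\<^sup>+w. ennreal ((norm (message i k w - batch_diff i k w))\<^sup>2) \<partial>M)
      = (\<integral>\<^sup>+w. (\<integral>\<^sup>+u. ennreal ((norm (Q u (batch_diff i k w) - batch_diff i k w))\<^sup>2) \<partial>U) \<partial>M)"
    using indep_pair_nn_integral[OF ind, of "\<lambda>z. ennreal ((norm (Q (snd z) (fst z) - fst z))\<^sup>2)"]
    by (simp add: distr_seed[OF i] message_def)
  also have "\<dots> \<le> (\<integral>\<^sup>+w. ennreal (\<omega> * (norm (batch_diff i k w))\<^sup>2) \<partial>M)"
  proof (rule nn_integral_mono)
    fix w
    have "integrable U (\<lambda>u. (norm (Q u y - y))\<^sup>2)" "(\<integral>u. (norm (Q u y - y))\<^sup>2 \<partial>U) \<le> \<omega> * (norm y)\<^sup>2" for y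
      using quantization by (auto simp: quantization_def)
    then show "(\<integral>\<^sup>+u. ennreal ((norm (Q u (batch_diff i k w) - batch_diff i k w))\<^sup>2) \<partial>U)
        \<le> ennreal (\<omega> * (norm (batch_diff i k w))\<^sup>2)"
      by (subst nn_integral_eq_integral) (auto intro: ennreal_leI)
  qed
  also have "\<dots> = ennreal (\<integral>w. \<omega> * (norm (batch_diff i k w))\<^sup>2 \<partial>M)"
    using int by (rule nn_integral_eq_integral) (use \<omega> in simp)
  finally have le: "(\<integral>\<^sup>+w. ennreal ((norm (message i k w - batch_diff i k w))\<^sup>2) \<partial>M)
      \<le> ennreal (\<omega> * (\<integral>w. (norm (batch_diff i k w))\<^sup>2 \<partial>M))" by simp
  show "square_integrable M (\<lambda>w. message i k w - batch_diff i k w)"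
    unfolding square_integrable_def
    using integrable_if_nn_integral_le(1)[OF _ _ _ le] \<omega> by simp
  show "(\<integral>w. (norm (message i k w - batch_diff i k w))\<^sup>2 \<partial>M)
      \<le> \<omega> * (\<integral>w. (norm (batch_diff i k w))\<^sup>2 \<partial>M)"
    using integrable_if_nn_integral_le(2)[OF _ _ _ le] \<omega> by simp
qed

text \<open>The sources in \<open>A\<close> determine both \<open>B\<close> and the quantizer input
  but leave out the seed. Averaging over the seed with the rest frozen gives zero by
  unbiasedness.\<close>

lemma quantization_error_orthogonal:
  assumes i: "i \<in> {1..n}"
    and A: "past k \<subseteq> A" "Minibatch i k \<in> A" "A \<subseteq> sources n" "Seed i k \<notin> A"
    and B: "B \<in> info 1 A \<rightarrow>\<^sub>M borel" "square_integrable M B"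
  shows "(\<integral>w. B w \<bullet> (message i k w - batch_diff i k w) \<partial>M) = 0"
proof -
  let ?X = "\<lambda>w. (B w, batch_diff i k w)"
  let ?h = "\<lambda>z. fst (fst z) \<bullet> (Q (snd z) (snd (fst z)) - snd (fst z))"
  have ind: "indep_pair (borel \<Otimes>\<^sub>M borel) ?X U (s i k)"
  proof (rule indep_pair_info[of 1 A "{Seed i k}"])
    have "batch_diff i k \<in> info 1 A \<rightarrow>\<^sub>M borel"
      using i A by (intro measurable_batch_diff measurable_past measurable_info) auto
    then show "?X \<in> info 1 A \<rightarrow>\<^sub>M borel \<Otimes>\<^sub>M borel" using B(1) by measurable
    show "s i k \<in> info 1 {Seed i k} \<rightarrow>\<^sub>M U"
      using i by (intro measurable_info) auto
  qed (use i A in \<open>auto simp: sourcesI\<close>)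
  have h: "?h \<in> borel_measurable ((borel \<Otimes>\<^sub>M borel) \<Otimes>\<^sub>M U)" by measurable
  have "integrable M (\<lambda>w. ?h (?X w, s i k w))"
    using square_integrable_inner[OF B(2) square_integrable_quantization_error(1)[OF i]]
    by (simp add: message_def)
  from indep_pair_integral[OF ind h this]
  have "(\<integral>w. B w \<bullet> (message i k w - batch_diff i k w) \<partial>M)
      = (\<integral>w. (\<integral>u. B w \<bullet> (Q u (batch_diff i k w) - batch_diff i k w) \<partial>U) \<partial>M)"
    by (simp add: message_def distr_seed[OF i])
  also have "\<dots> = 0"
  proof -
    have "integrable U (\<lambda>u. Q u y)" "(\<integral>u. Q u y \<partial>U) = y" for y
      using quantization by (auto simp: quantization_def)
    then have "(\<integral>u. v \<bullet> (Q u y - y) \<partial>U) = 0" for v y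
      by (simp add: U.prob_space)
    then show ?thesis by simp
  qed
  finally show ?thesis .
qed

lemma square_integrable_message_error:
  assumes i: "i \<in> {1..n}"
  shows "square_integrable M (\<lambda>w. message i k w - diff i k w)"
  using square_integrable_add[OF square_integrable_quantization_error(1)[OF i] square_integrable_minibatch_error(1)[OF i]]
  by simp

text \<open>The error is split at \<open>batch_diff\<close>. For the quantization part the minibatch
  joins the conditioning sources, as the quantizer input depends on it; for the minibatch part it
  has to stay outside.\<close>

lemma message_error_orthogonal:
  assumes i: "i \<in> {1..n}"
    and A: "past k \<subseteq> A" "A \<subseteq> sources n" "Minibatch i k \<notin> A" "Seed i k \<notin> A"
    and B: "B \<in> info 1 A \<rightarrow>\<^sub>M borel" "square_integrable M B"
  shows "(\<integral>w. B w \<bullet> (message i k w - diff i k w) \<partial>M) = 0"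
proof -
  have "B \<in> info 1 (insert (Minibatch i k) A) \<rightarrow>\<^sub>M borel"
    using B(1) by (rule measurable_info_mono[rotated]) auto
  then have "(\<integral>w. B w \<bullet> (message i k w - batch_diff i k w) \<partial>M) = 0"
    using i A B(2) by (intro quantization_error_orthogonal[of i "insert (Minibatch i k) A"])
      (auto simp: sourcesI)
  moreover have "(\<integral>w. B w \<bullet> (batch_diff i k w - diff i k w) \<partial>M) = 0"
    using i A B by (intro minibatch_error_orthogonal[of i A])
  moreover have "(\<integral>w. B w \<bullet> (message i k w - diff i k w) \<partial>M)
      = (\<integral>w. B w \<bullet> (message i k w - batch_diff i k w) + B w \<bullet> (batch_diff i k w - diff i k w) \<partial>M)"
    by (simp add: inner_diff_right)
  ultimately show ?thesis
    using square_integrable_inner[OF B(2) square_integrable_quantization_error(1)[OF i]]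
      square_integrable_inner[OF B(2) square_integrable_minibatch_error(1)[OF i]]
    by simp
qed

text \<open>Pythagoras twice. The quantization error is at most \<omega> times the second moment of
  \<open>batch_diff\<close>, which is that of \<open>diff\<close> plus that of the minibatch error.
  The latter thus counts once directly and \<omega> times through the quantizer, whence the factor
  \<open>1 + \<omega>\<close>.\<close>

lemma message_error_bound:
  assumes i: "i \<in> {1..n}"
  shows "(\<integral>w. (norm (message i k w - diff i k w))\<^sup>2 \<partial>M)
    \<le> (\<omega> * (Ls i)\<^sup>2 + (1 + \<omega>) * (\<L>s i)\<^sup>2 / real b) * (\<integral>w. (norm (step k w))\<^sup>2 \<partial>M)"
proof -
  have \<omega>: "0 < \<omega>" using quantization by (simp add: quantization_def)
  let ?A = "past k \<union> {Minibatch i k}"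
  let ?me = "\<integral>w. (norm (batch_diff i k w - diff i k w))\<^sup>2 \<partial>M"
  have "(\<lambda>w. batch_diff i k w - diff i k w) \<in> info 1 ?A \<rightarrow>\<^sub>M borel"
    using i by (intro borel_measurable_diff measurable_batch_diff measurable_diff measurable_past measurable_info) auto
  then have "(\<integral>w. (batch_diff i k w - diff i k w) \<bullet> (message i k w - batch_diff i k w) \<partial>M) = 0"
    using i past_sources square_integrable_minibatch_error(1)[OF i]
    by (intro quantization_error_orthogonal[of i ?A]) (auto simp: past_mem sourcesI)
  from integral_norm_add_orthogonal[OF _ _ this]
  have "(\<integral>w. (norm (message i k w - diff i k w))\<^sup>2 \<partial>M)
      = ?me + (\<integral>w. (norm (message i k w - batch_diff i k w))\<^sup>2 \<partial>M)"
    using square_integrable_minibatch_error(1)[OF i] square_integrable_quantization_error(1)[OF i] by simp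
  also have "\<dots> \<le> ?me + \<omega> * (\<integral>w. (norm (batch_diff i k w))\<^sup>2 \<partial>M)"
    using square_integrable_quantization_error(2)[OF i] by simp
  also have "(\<integral>w. (norm (batch_diff i k w))\<^sup>2 \<partial>M) = (\<integral>w. (norm (diff i k w))\<^sup>2 \<partial>M) + ?me"
  proof -
    have "diff i k \<in> info 1 (past k) \<rightarrow>\<^sub>M borel"
      using i by (intro measurable_diff measurable_past) auto
    then have "(\<integral>w. diff i k w \<bullet> (batch_diff i k w - diff i k w) \<partial>M) = 0"
      using i past_sources square_integrable_diff_grad(1)[OF i]
      by (intro minibatch_error_orthogonal[of i "past k"]) (auto simp: past_mem)
    from integral_norm_add_orthogonal[OF _ _ this] show ?thesis
      using square_integrable_minibatch_error(1)[OF i] square_integrable_diff_grad(1)[OF i] by simp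
  qed
  also have "?me + \<omega> * ((\<integral>w. (norm (diff i k w))\<^sup>2 \<partial>M) + ?me)
      = \<omega> * (\<integral>w. (norm (diff i k w))\<^sup>2 \<partial>M) + (1 + \<omega>) * ?me" by (simp add: algebra_simps)
  also have "\<dots> \<le> \<omega> * ((Ls i)\<^sup>2 * (\<integral>w. (norm (step k w))\<^sup>2 \<partial>M))
      + (1 + \<omega>) * ((\<L>s i)\<^sup>2 / real b * (\<integral>w. (norm (step k w))\<^sup>2 \<partial>M))"
    using square_integrable_diff_grad(2)[OF i] square_integrable_minibatch_error(2)[OF i] \<omega>
    by (intro add_mono mult_left_mono) auto
  finally show ?thesis by (simp add: algebra_simps)
qed

text \<open>The next estimation error on the event that the coin shows \<open>False\<close>, see
  \<open>err_Suc\<close>.\<close>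

abbreviation "compressed w \<equiv> err k w + (1 / real n) *\<^sub>R (\<Sum>i=1..n. message i k w - diff i k w)"

lemma square_integrable_compressed: "square_integrable M compressed"
  by (intro square_integrable_add square_integrable_err square_integrable_scaleR square_integrable_sum
      finite_measure_axioms square_integrable_message_error)

text \<open>The errors of the workers are uncorrelated with each other and with the old error, which
  yields the factor \<open>1 / n\<close>.\<close>

lemma compressed_error_bound:
  "(\<integral>w. (norm (compressed w))\<^sup>2 \<partial>M) \<le> (\<integral>w. (norm (err k w))\<^sup>2 \<partial>M)
    + (\<Sum>i=1..n. \<omega> * (Ls i)\<^sup>2 + (1 + \<omega>) * (\<L>s i)\<^sup>2 / real b) / (real n)\<^sup>2 * (\<integral>w. (norm (step k w))\<^sup>2 \<partial>M)"
proof -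
  let ?me = "\<lambda>i w. message i k w - diff i k w"
  let ?S = "\<lambda>w. \<Sum>i=1..n. ?me i w"
  have me: "i \<in> {1..n} \<Longrightarrow> square_integrable M (?me i)" for i
    by (rule square_integrable_message_error)
  have S: "square_integrable M ?S"
    by (intro square_integrable_sum finite_measure_axioms me)
  have err: "err k \<in> info 1 (past k) \<rightarrow>\<^sub>M borel"
  proof -
    note [measurable] = measurable_past[OF subset_refl]
    show ?thesis unfolding err_def[abs_def] by measurable
  qed
  have "(\<integral>w. err k w \<bullet> ((1 / real n) *\<^sub>R ?S w) \<partial>M) = (1 / real n) * (\<integral>w. err k w \<bullet> ?S w \<partial>M)"
    by simp
  also have "(\<integral>w. err k w \<bullet> ?S w \<partial>M) = (\<Sum>i=1..n. \<integral>w. err k w \<bullet> ?me i w \<partial>M)"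
    using square_integrable_err me by (rule integral_inner_sum)
  also have "\<dots> = 0"
    using err square_integrable_err past_sources
    by (intro sum.neutral ballI message_error_orthogonal[of _ "past k"]) (auto simp: past_mem)
  finally have "(\<integral>w. (norm (compressed w))\<^sup>2 \<partial>M)
      = (\<integral>w. (norm (err k w))\<^sup>2 \<partial>M) + (\<integral>w. (norm ((1 / real n) *\<^sub>R ?S w))\<^sup>2 \<partial>M)"
    using square_integrable_err S by (intro integral_norm_add_orthogonal) auto
  also have "(\<integral>w. (norm ((1 / real n) *\<^sub>R ?S w))\<^sup>2 \<partial>M) = (\<integral>w. (norm (?S w))\<^sup>2 \<partial>M) / (real n)\<^sup>2"
    by (simp add: power_divide)
  finally have split: "(\<integral>w. (norm (compressed w))\<^sup>2 \<partial>M)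
      = (\<integral>w. (norm (err k w))\<^sup>2 \<partial>M) + (\<integral>w. (norm (?S w))\<^sup>2 \<partial>M) / (real n)\<^sup>2" .
  have "(\<integral>w. (norm (?S w))\<^sup>2 \<partial>M) = (\<Sum>i=1..n. \<integral>w. (norm (?me i w))\<^sup>2 \<partial>M)"
  proof (rule integral_norm_sum_orthogonal)
    fix i j assume ij: "i \<in> {1..n}" "j \<in> {1..n}" "i \<noteq> j"
    \<comment> \<open>The minibatch and the seed of worker \<open>i\<close> may join the past in the
      conditioning, since worker \<open>j\<close> has its own.\<close>
    have "?me i \<in> info 1 (past k \<union> {Minibatch i k, Seed i k}) \<rightarrow>\<^sub>M borel"
      using ij by (intro borel_measurable_diff measurable_message measurable_diff measurable_past measurable_info) auto
    then show "(\<integral>w. ?me i w \<bullet> ?me j w \<partial>M) = 0"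
      using ij past_sources me[OF ij(1)]
      by (intro message_error_orthogonal[of j "past k \<union> {Minibatch i k, Seed i k}"])
        (auto simp: past_mem sourcesI)
  qed (use me finite_measure_axioms in auto)
  also have "\<dots> \<le> (\<Sum>i=1..n. (\<omega> * (Ls i)\<^sup>2 + (1 + \<omega>) * (\<L>s i)\<^sup>2 / real b) * (\<integral>w. (norm (step k w))\<^sup>2 \<partial>M))"
    by (intro sum_mono message_error_bound)
  also have "\<dots> = (\<Sum>i=1..n. \<omega> * (Ls i)\<^sup>2 + (1 + \<omega>) * (\<L>s i)\<^sup>2 / real b) * (\<integral>w. (norm (step k w))\<^sup>2 \<partial>M)"
    by (rule sum_distrib_right[symmetric])
  finally show ?thesis
    unfolding split times_divide_eq_left by (intro add_left_mono divide_right_mono) simp_all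
qed

lemma square_integrable_err_Suc: "square_integrable M (err (Suc k))"
proof -
  note [measurable] = rv(1)
  have "square_integrable M (\<lambda>w. if c k w then 0 else compressed w)"
    by (intro square_integrable_If square_integrable_const square_integrable_compressed finite_measure_axioms)
      measurable
  then show ?thesis using err_Suc by (subst square_integrable_cong) auto
qed

lemma square_integrable_g_Suc: "square_integrable M (g (Suc k))"
  using square_integrable_add[OF square_integrable_err_Suc square_integrable_gradient_f[OF square_integrable_x_Suc]]
  by (simp add: err_def)

text \<open>The error vanishes on a \<open>True\<close> coin, and the coin is independent of
  everything that \<open>compressed\<close> reads, so the second moment of \<open>compressed\<close>
  is multiplied by the probability \<open>1 - p\<close> of \<open>False\<close>.\<close>

lemma err_recursion:
  "(\<integral>w. (norm (err (Suc k) w))\<^sup>2 \<partial>M) \<le> (1 - p) * ((\<integral>w. (norm (err k w))\<^sup>2 \<partial>M)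
    + (\<Sum>i=1..n. \<omega> * (Ls i)\<^sup>2 + (1 + \<omega>) * (\<L>s i)\<^sup>2 / real b) / (real n)\<^sup>2 * (\<integral>w. (norm (step k w))\<^sup>2 \<partial>M))"
proof -
  note [measurable] = rv(1)
  \<comment> \<open>All sources read by \<open>compressed\<close>: those of earlier iterations and,
    in iteration \<open>k\<close>, everything but the coin.\<close>
  define A where "A = past k \<union> {Minibatch i k |i. i \<in> {1..n}} \<union> {Seed i k |i. i \<in> {1..n}}"
  have A: "past k \<subseteq> A" "i \<in> {1..n} \<Longrightarrow> Minibatch i k \<in> A" "i \<in> {1..n} \<Longrightarrow> Seed i k \<in> A" for i
    by (auto simp: A_def)
  let ?I = "\<lambda>w. indicator {False} (c k w) :: real"
  have ind: "indep_pair borel ?I borel (\<lambda>w. (norm (compressed w))\<^sup>2)"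
  proof (rule indep_pair_info[of 1 "{Coin k}" A])
    have "c k \<in> info 1 {Coin k} \<rightarrow>\<^sub>M count_space UNIV" by (intro measurable_info) simp
    then show "?I \<in> info 1 {Coin k} \<rightarrow>\<^sub>M borel" by (rule measurable_compose) simp
    note [measurable] = measurable_past[OF A(1)]
    have [measurable]: "i \<in> {1..n} \<Longrightarrow> message i k \<in> info 1 A \<rightarrow>\<^sub>M borel" for i
      by (intro measurable_message measurable_info measurable_past A)
    have [measurable]: "i \<in> {1..n} \<Longrightarrow> diff i k \<in> info 1 A \<rightarrow>\<^sub>M borel" for i
      by (intro measurable_diff measurable_past A)
    show "(\<lambda>w. (norm (compressed w))\<^sup>2) \<in> info 1 A \<rightarrow>\<^sub>M borel"
      unfolding err_def by measurable
  qed (use past_sources in \<open>auto simp: A_def past_mem sourcesI\<close>)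
  have intI: "integrable M ?I"
    by (rule integrable_const_bound[where B = 1]) (auto simp: indicator_def)
  have ind: "indep_var borel ?I borel (\<lambda>w. (norm (compressed w))\<^sup>2)"
    using indep_pairD[OF ind] by (simp add: indep_var_distribution_eq)
  have "(\<integral>w. (norm (err (Suc k) w))\<^sup>2 \<partial>M) = (\<integral>w. ?I w * (norm (compressed w))\<^sup>2 \<partial>M)"
    by (rule Bochner_Integration.integral_cong) (auto simp: err_Suc)
  also have "\<dots> = (\<integral>w. ?I w \<partial>M) * (\<integral>w. (norm (compressed w))\<^sup>2 \<partial>M)"
    using ind intI square_integrableD(2)[OF square_integrable_compressed]
    by (rule indep_var_lebesgue_integral)
  also have "(\<integral>w. ?I w \<partial>M) = (\<integral>w. indicator {w \<in> space M. \<not> c k w} w \<partial>M)"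
    by (rule Bochner_Integration.integral_cong) (auto simp: indicator_def)
  also have "\<dots> = 1 - p"
  proof -
    have "{w \<in> space M. \<not> c k w} \<inter> space M = {w \<in> space M. \<not> c k w}" by auto
    then show ?thesis using coin_prob(1) by simp
  qed
  also have "(1 - p) * (\<integral>w. (norm (compressed w))\<^sup>2 \<partial>M) \<le> (1 - p) * ((\<integral>w. (norm (err k w))\<^sup>2 \<partial>M)
    + (\<Sum>i=1..n. \<omega> * (Ls i)\<^sup>2 + (1 + \<omega>) * (\<L>s i)\<^sup>2 / real b) / (real n)\<^sup>2 * (\<integral>w. (norm (step k w))\<^sup>2 \<partial>M))"
    using p01 compressed_error_bound by (intro mult_left_mono) auto
  finally show ?thesis .
qed

end

text \<open>The one-step estimates assume square integrability of the current iterates; induction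
  from the constant starting values discharges this assumption for the whole run.\<close>

lemma square_integrable_xg: "square_integrable M (x k) \<and> square_integrable M (g k)"
proof (induction k)
  case 0
  have "square_integrable M (x 0)"
    using run(1) square_integrable_const[OF finite_measure_axioms, of x0]
    by (subst square_integrable_cong) auto
  moreover have "square_integrable M (g 0)"
    using run(2) square_integrable_const[OF finite_measure_axioms, of "gradient f x0"]
    by (subst square_integrable_cong) auto
  ultimately show ?case ..
next
  case (Suc k)
  then show ?case using square_integrable_x_Suc square_integrable_g_Suc by blast
qed

lemmas square_integrable_x = square_integrable_xg[THEN conjunct1]
lemmas square_integrable_g = square_integrable_xg[THEN conjunct2]

end


context vr_marina_run
begin

section \<open>Convergence\<close>

lemma differentiable_f: "f differentiable (at y)"
  using GDERIV_global_loss[of n m fs y] differentiable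
  unfolding gderiv_def differentiable_def by blast

text \<open>The triangle inequality yields the arithmetic mean of the constants \<open>Ls i\<close>,
  which is at most their quadratic mean.\<close>

lemma gradient_f_lipschitz:
  "norm (gradient f y - gradient f z) \<le> sqrt ((\<Sum>i=1..n. (Ls i)\<^sup>2) / real n) * norm (y - z)"
proof -
  have n0: "0 < real n" using n by simp
  have "norm (gradient f y - gradient f z) = norm (\<Sum>i=1..n. G i y - G i z) / real n"
    by (simp add: gradient_f scaleR_diff_right[symmetric] sum_subtractf)
  also have "\<dots> \<le> (\<Sum>i=1..n. Ls i * norm (y - z)) / real n"
    by (intro divide_right_mono sum_norm_le G_lipschitz) auto
  also have "\<dots> = (\<Sum>i=1..n. Ls i) / real n * norm (y - z)"
    by (simp add: sum_distrib_right)
  also have "\<dots> \<le> sqrt ((\<Sum>i=1..n. (Ls i)\<^sup>2) / real n) * norm (y - z)"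
  proof (intro mult_right_mono real_le_rsqrt)
    have "(\<Sum>i=1..n. Ls i)\<^sup>2 \<le> (\<Sum>i=1..n. (Ls i)\<^sup>2) * real n"
      using sum_squared_le_sum_of_squares[of Ls "{1..n}"] by simp
    then show "((\<Sum>i=1..n. Ls i) / real n)\<^sup>2 \<le> (\<Sum>i=1..n. (Ls i)\<^sup>2) / real n"
      using n0 by (simp add: power_divide field_simps power2_eq_square)
  qed simp
  finally show ?thesis .
qed

lemma integrable_grad_norm: "integrable M (\<lambda>w. (norm (gradient f (x k w)))\<^sup>2)"
  using square_integrable_gradient_f[OF square_integrable_x] by (rule square_integrableD)

text \<open>Expectation of \<open>gradient_descent_bound\<close>. Integrability of
  \<open>f (x k w)\<close> follows by induction, since the next value lies between
  \<open>f_low\<close> and an integrable upper bound.\<close>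

lemma descent_step:
  assumes low: "\<And>y. f_low \<le> f y"
    and lip: "\<And>y z. norm (gradient f y - gradient f z) \<le> L * norm (y - z)"
  shows "integrable M (\<lambda>w. f (x k w))"
    and "(\<integral>w. f (x (Suc k) w) \<partial>M) \<le> (\<integral>w. f (x k w) \<partial>M)
      - \<gamma> / 2 * (\<integral>w. (norm (gradient f (x k w)))\<^sup>2 \<partial>M) + \<gamma> / 2 * (\<integral>w. (norm (err k w))\<^sup>2 \<partial>M)
      - (1 / (2 * \<gamma>) - L / 2) * (\<integral>w. (norm (step k w))\<^sup>2 \<partial>M)"
proof -
  let ?r = "\<lambda>k w. f (x k w) - \<gamma> / 2 * (norm (gradient f (x k w)))\<^sup>2 + \<gamma> / 2 * (norm (err k w))\<^sup>2
      - (1 / (2 * \<gamma>) - L / 2) * (norm (step k w))\<^sup>2"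
  have le: "f (x (Suc k) w) \<le> ?r k w" if "w \<in> space M" for k w
    using gradient_descent_bound[OF differentiable_f lip \<gamma>, of "x k w" "g k w"] run(3)[OF that, of k]
    by (simp add: err_def)
  have [measurable]: "f \<in> borel_measurable borel"
    by (intro borel_measurable_continuous_onI)
      (meson differentiable_f continuous_at_imp_continuous_on differentiable_imp_continuous_within)
  have quad: "integrable M (\<lambda>w. (norm (gradient f (x k w)))\<^sup>2)" "integrable M (\<lambda>w. (norm (err k w))\<^sup>2)"
    "integrable M (\<lambda>w. (norm (step k w))\<^sup>2)" for k
    using integrable_grad_norm square_integrableD(2)[OF square_integrable_err[OF square_integrable_x square_integrable_g]]
      square_integrableD(2)[OF square_integrable_step[OF square_integrable_x square_integrable_g]] by auto
  have int: "integrable M (\<lambda>w. f (x k w))" for k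
  proof (induction k)
    case 0
    show ?case using run(1) by (subst Bochner_Integration.integrable_cong[where g = "\<lambda>_. f x0"]) auto
  next
    case (Suc k)
    show ?case
    proof (rule Bochner_Integration.integrable_bound)
      show "integrable M (\<lambda>w. \<bar>f_low\<bar> + \<bar>?r k w\<bar>)" using Suc quad[of k] by auto
      show "AE w in M. norm (f (x (Suc k) w)) \<le> norm (\<bar>f_low\<bar> + \<bar>?r k w\<bar>)"
      proof (rule AE_I2)
        fix w assume "w \<in> space M"
        from le[OF this, of k] low[of "x (Suc k) w"]
        show "norm (f (x (Suc k) w)) \<le> norm (\<bar>f_low\<bar> + \<bar>?r k w\<bar>)" unfolding real_norm_def by linarith
      qed
    qed measurable
  qed
  then show "integrable M (\<lambda>w. f (x k w))" .
  have "(\<integral>w. f (x (Suc k) w) \<partial>M) \<le> (\<integral>w. ?r k w \<partial>M)"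
    using int quad[of k] le by (intro integral_mono) auto
  then show "(\<integral>w. f (x (Suc k) w) \<partial>M) \<le> (\<integral>w. f (x k w) \<partial>M)
      - \<gamma> / 2 * (\<integral>w. (norm (gradient f (x k w)))\<^sup>2 \<partial>M) + \<gamma> / 2 * (\<integral>w. (norm (err k w))\<^sup>2 \<partial>M)
      - (1 / (2 * \<gamma>) - L / 2) * (\<integral>w. (norm (step k w))\<^sup>2 \<partial>M)"
    using int[of k] quad[of k] by simp
qed

text \<open>With the averages of the squared constants written as \<open>L\<^sup>2\<close> and
  \<open>\<L>\<^sup>2\<close>, this is \<open>(\<omega> * L\<^sup>2 + (1 + \<omega>) * \<L>\<^sup>2
  / b) / n\<close>: one of the two factors \<open>n\<close> is used up by the averages.\<close>

definition variance_const :: real where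
  "variance_const = (\<Sum>i=1..n. \<omega> * (Ls i)\<^sup>2 + (1 + \<omega>) * (\<L>s i)\<^sup>2 / real b) / (real n)\<^sup>2"

text \<open>Telescopes the Lyapunov function \<open>E f(x\<^sup>k) + \<gamma> / (2p) E \<parallel>g\<^sup>k - \<nabla>f(x\<^sup>k)\<parallel>\<^sup>2\<close>.\<close>

lemma sum_gradient_norm_le:
  assumes low: "\<And>y. f_low \<le> f y"
    and lip: "\<And>y z. norm (gradient f y - gradient f z) \<le> L * norm (y - z)"
    and p: "0 < p" and coeff: "\<gamma> / 2 * ((1 - p) / p * variance_const) \<le> 1 / (2 * \<gamma>) - L / 2"
  shows "\<gamma> / 2 * (\<Sum>k<K. \<integral>w. (norm (gradient f (x k w)))\<^sup>2 \<partial>M) \<le> f x0 - f_low"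
proof -
  define F where "F k = (\<integral>w. f (x k w) \<partial>M)" for k
  define e where "e k = (\<integral>w. (norm (err k w))\<^sup>2 \<partial>M)" for k
  define D where "D k = (\<integral>w. (norm (step k w))\<^sup>2 \<partial>M)" for k
  define N where "N k = (\<integral>w. (norm (gradient f (x k w)))\<^sup>2 \<partial>M)" for k
  define \<Phi> where "\<Phi> k = F k + \<gamma> / (2 * p) * e k" for k
  have step: "\<Phi> (Suc k) \<le> \<Phi> k - \<gamma> / 2 * N k" for k
  proof -
    have "F (Suc k) \<le> F k - \<gamma> / 2 * N k + \<gamma> / 2 * e k - (1 / (2 * \<gamma>) - L / 2) * D k"
      unfolding F_def e_def D_def N_def by (rule descent_step(2)[OF low lip])
    moreover have "\<gamma> / (2 * p) * e (Suc k) \<le> \<gamma> / (2 * p) * ((1 - p) * (e k + variance_const * D k))"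
      using err_recursion[OF square_integrable_x square_integrable_g, of k] \<gamma> p
      unfolding e_def D_def variance_const_def by (intro mult_left_mono) auto
    \<comment> \<open>The weight \<open>\<gamma> / (2 * p)\<close> is made for this: multiplied by
      \<open>1 - p\<close> it falls by exactly \<open>\<gamma> / 2\<close>, the coefficient of
      \<open>e k\<close> in the descent inequality.\<close>
    moreover have "\<gamma> / (2 * p) * ((1 - p) * (e k + variance_const * D k))
        = \<gamma> / (2 * p) * e k - \<gamma> / 2 * e k + \<gamma> / 2 * ((1 - p) / p * variance_const) * D k"
      using p by (simp add: field_simps)
    moreover have "\<gamma> / 2 * ((1 - p) / p * variance_const) * D k \<le> (1 / (2 * \<gamma>) - L / 2) * D k"
      using coeff by (rule mult_right_mono) (simp add: D_def)
    ultimately show ?thesis unfolding \<Phi>_def by linarith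
  qed
  have tele: "\<gamma> / 2 * (\<Sum>k<K. N k) \<le> \<Phi> 0 - \<Phi> K"
  proof (induction K)
    case (Suc K)
    have "\<gamma> / 2 * (\<Sum>k<Suc K. N k) = \<gamma> / 2 * (\<Sum>k<K. N k) + \<gamma> / 2 * N K"
      by (simp add: distrib_left)
    then show ?case using Suc step[of K] by linarith
  qed simp
  \<comment> \<open>The run starts with the exact gradient, so the initial error term is
    zero.\<close>
  have "\<Phi> 0 = f x0"
  proof -
    have "F 0 = (\<integral>w. f x0 \<partial>M)"
      unfolding F_def by (rule Bochner_Integration.integral_cong) (auto simp: run(1))
    moreover have "e 0 = (\<integral>w. 0 \<partial>M)"
      unfolding e_def by (rule Bochner_Integration.integral_cong) (auto simp: run(1,2) err_def)
    ultimately show ?thesis by (simp add: \<Phi>_def prob_space)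
  qed
  moreover have "f_low \<le> \<Phi> K"
  proof -
    have "(\<integral>w. f_low \<partial>M) \<le> F K"
      unfolding F_def using low descent_step(1)[OF low lip] by (intro integral_mono) auto
    moreover have "0 \<le> \<gamma> / (2 * p) * e K" using \<gamma> p by (simp add: e_def)
    ultimately show ?thesis by (simp add: \<Phi>_def prob_space)
  qed
  ultimately show ?thesis using tele unfolding N_def by linarith
qed

section \<open>The returned point\<close>

lemma output_prob:
  assumes "1 \<le> K" "k < K"
  shows "(\<integral>w. indicat_real {k} (\<tau> K w) \<partial>M) = 1 / real K"
proof -
  note [measurable] = rv(4)[OF assms(1)]
  have D: "distr M (count_space UNIV) (\<tau> K) = measure_pmf (pmf_of_set {..<K})"
    using sampling assms(1) by (simp add: sampling_def)
  have "(\<integral>w. indicat_real {k} (\<tau> K w) \<partial>M) = (\<integral>t. indicat_real {k} t \<partial>distr M (count_space UNIV) (\<tau> K))"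
    by (subst integral_distr) auto
  also have "\<dots> = pmf (pmf_of_set {..<K}) k"
    unfolding D by (simp add: measure_pmf_single)
  also have "\<dots> = 1 / real K"
    using assms by (subst pmf_of_set) (auto simp: lessThan_empty_iff)
  finally show ?thesis .
qed

text \<open>The expectation is split according to the value of \<open>\<tau> K\<close>. The index is
  independent of \<open>x k\<close>, so each product of indicator and squared norm factorizes, and
  every \<open>k < K\<close> has weight \<open>1 / K\<close>.\<close>

lemma output_gradient_norm:
  assumes K: "1 \<le> K"
  shows "integrable M (\<lambda>w. (norm (gradient f (x (\<tau> K w) w)))\<^sup>2)" (is "integrable M ?h")
    and "(\<integral>w. (norm (gradient f (x (\<tau> K w) w)))\<^sup>2 \<partial>M)
      = (\<Sum>k<K. \<integral>w. (norm (gradient f (x k w)))\<^sup>2 \<partial>M) / real K"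
proof -
  note \<tau>K = rv(4)[OF K]
  note [measurable] = \<tau>K
  let ?I = "\<lambda>k w. indicator {k} (\<tau> K w) :: real" and ?N = "\<lambda>k w. (norm (gradient f (x k w)))\<^sup>2"
  have I: "integrable M (?I k)" for k
    by (rule integrable_const_bound[where B = 1]) (auto simp: indicator_def)
  have ind: "indep_var borel (?I k) borel (?N k)" for k
  proof -
    have "indep_pair borel (?I k) borel (?N k)"
    proof (rule indep_pair_info[of K "{Output}" "past k"])
      have "\<tau> K \<in> info K {Output} \<rightarrow>\<^sub>M count_space UNIV" using K by (intro measurable_info) simp
      then show "?I k \<in> info K {Output} \<rightarrow>\<^sub>M borel" by (rule measurable_compose) simp
      note [measurable] = measurable_past[OF subset_refl]
      show "?N k \<in> info K (past k) \<rightarrow>\<^sub>M borel" by measurable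
    qed (use K past_sources in \<open>auto simp: past_mem sourcesI\<close>)
    then show ?thesis using indep_pairD[of borel "?I k" borel "?N k"] by (simp add: indep_var_distribution_eq)
  qed
  have int: "integrable M (\<lambda>w. ?I k w * ?N k w)" for k
    using ind I integrable_grad_norm by (rule indep_var_integrable)
  have meas: "?h \<in> borel_measurable M"
    by (rule measurable_compose_countable[OF _ \<tau>K, of "\<lambda>k w. ?N k w"]) measurable
  have "AE t in distr M (count_space UNIV) (\<tau> K). t < K"
  proof -
    have D: "distr M (count_space UNIV) (\<tau> K) = measure_pmf (pmf_of_set {..<K})"
      using sampling K by (simp add: sampling_def)
    show ?thesis unfolding D AE_measure_pmf_iff using K by (subst set_pmf_of_set) (auto simp: lessThan_empty_iff)
  qed
  then have "AE w in M. \<tau> K w < K" by (rule AE_distrD[OF \<tau>K])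
  then have eq: "AE w in M. (\<Sum>k<K. ?I k w * ?N k w) = ?h w"
  proof eventually_elim
    case (elim w)
    have "(\<Sum>k<K. ?I k w * ?N k w) = (\<Sum>k<K. if k = \<tau> K w then ?h w else 0)"
      by (intro sum.cong) (auto simp: indicator_def)
    then show ?case using elim by simp
  qed
  have int_sum: "integrable M (\<lambda>w. \<Sum>k<K. ?I k w * ?N k w)"
    using int by (intro Bochner_Integration.integrable_sum)
  show "integrable M ?h"
    using int_sum integrable_cong_AE[THEN iffD1, OF _ meas eq] borel_measurable_integrable by blast
  have "integral\<^sup>L M ?h = (\<integral>w. (\<Sum>k<K. ?I k w * ?N k w) \<partial>M)"
    using integral_cong_AE[OF borel_measurable_integrable[OF int_sum] meas eq] by simp
  also have "\<dots> = (\<Sum>k<K. (\<integral>w. ?I k w * ?N k w \<partial>M))"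
    using int by (rule Bochner_Integration.integral_sum)
  also have "\<dots> = (\<Sum>k<K. 1 / real K * (\<integral>w. ?N k w \<partial>M))"
    using indep_var_lebesgue_integral[OF ind I integrable_grad_norm] output_prob[OF K]
    by (intro sum.cong) simp_all
  finally show "integral\<^sup>L M ?h = (\<Sum>k<K. \<integral>w. ?N k w \<partial>M) / real K"
    by (simp add: sum_divide_distrib)
qed

section \<open>Costs\<close>

lemma coin_integral:
  fixes a a' :: real
  shows "integrable M (\<lambda>w. if c k w then a else a')"
    and "(\<integral>w. (if c k w then a else a') \<partial>M) = p * a + (1 - p) * a'"
proof -
  note [measurable] = rv(1)
  show "integrable M (\<lambda>w. if c k w then a else a')"
    by (rule integrable_const_bound[where B = "\<bar>a\<bar> + \<bar>a'\<bar>"]) auto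
  have "(\<integral>w. (if c k w then a else a') \<partial>M)
      = (\<integral>w. a' + (a - a') * indicator {w \<in> space M. c k w} w \<partial>M)"
    by (rule Bochner_Integration.integral_cong) auto
  also have "\<dots> = a' + (a - a') * measure M ({w \<in> space M. c k w} \<inter> space M)"
  proof -
    have "integrable M (indicat_real {w \<in> space M. c k w})"
      by (rule integrable_const_bound[where B = 1]) (auto simp: indicator_def)
    then show ?thesis by (simp add: prob_space)
  qed
  also have "{w \<in> space M. c k w} \<inter> space M = {w \<in> space M. c k w}" by auto
  finally show "(\<integral>w. (if c k w then a else a') \<partial>M) = p * a + (1 - p) * a'"
    by (simp add: coin_prob algebra_simps)
qed

text \<open>Every minibatch has exactly \<open>b\<close> elements, so the cost depends on the coins
  only. Full gradients cost at most \<open>b\<close> calls per iteration in expectation, minibatches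
  at most \<open>2 * b\<close>.\<close>

lemma expected_oracle_calls:
  assumes i: "i \<in> {1..n}" and pm: "p * real m \<le> real b"
  shows "integrable M (\<lambda>w. real (oracle_calls m c J K i w))"
    and "(\<integral>w. real (oracle_calls m c J K i w) \<partial>M) \<le> real m + 3 * real b * real K"
proof -
  have eq: "real (oracle_calls m c J K i w)
      = real m + (\<Sum>k<K. if c k w then real m else 2 * real b)" if "w \<in> space M" for w
  proof -
    have "card (J i k w) = b" for k using measurable_space[OF rv(2)[OF i, of k] that] by simp
    then show ?thesis by (simp add: oracle_calls_def of_nat_sum if_distrib cong: if_cong)
  qed
  have int: "integrable M (\<lambda>w. real m + (\<Sum>k<K. if c k w then real m else 2 * real b))"
    using coin_integral(1) by auto
  then show "integrable M (\<lambda>w. real (oracle_calls m c J K i w))"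
    using eq by (subst Bochner_Integration.integrable_cong) auto
  have "(\<integral>w. real (oracle_calls m c J K i w) \<partial>M)
      = (\<integral>w. real m + (\<Sum>k<K. if c k w then real m else 2 * real b) \<partial>M)"
    using eq by (intro Bochner_Integration.integral_cong) auto
  also have "\<dots> = real m + real K * (p * real m + (1 - p) * (2 * real b))"
    using coin_integral by (simp add: Bochner_Integration.integral_sum prob_space)
  also have "\<dots> \<le> real m + real K * (real b + 1 * (2 * real b))"
    using pm p01 by (intro add_left_mono mult_left_mono add_mono mult_right_mono) auto
  finally show "(\<integral>w. real (oracle_calls m c J K i w) \<partial>M) \<le> real m + 3 * real b * real K"
    by (simp add: algebra_simps)
qed

text \<open>With the quantizer input frozen, the mean over the seed is one of the values whose
  supremum is \<open>expected_density\<close>.\<close>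

lemma expected_message_density:
  assumes i: "i \<in> {1..n}"
  shows "integrable M (\<lambda>w. real (nnz (message i k w)))"
    and "(\<integral>w. real (nnz (message i k w)) \<partial>M) \<le> expected_density U Q"
proof -
  note [measurable] = measurable_M(5)[OF i]
  note dens = expected_density_pos[OF quantization]
  have "(\<integral>\<^sup>+w. ennreal (real (nnz (message i k w))) \<partial>M)
      = (\<integral>\<^sup>+w. (\<integral>\<^sup>+u. ennreal (real (nnz (Q u (batch_diff i k w)))) \<partial>U) \<partial>M)"
    using indep_pair_nn_integral[OF indep_pair_batch_diff_seed[OF i],
        of "\<lambda>z. ennreal (real (nnz (Q (snd z) (fst z))))"]
    by (simp add: distr_seed[OF i] message_def)
  also have "\<dots> \<le> (\<integral>\<^sup>+w. ennreal (expected_density U Q) \<partial>M)"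
  proof (rule nn_integral_mono)
    fix w
    have "integrable U (\<lambda>u. real (nnz (Q u y)))" for y
      by (rule U.integrable_const_bound[where B = "real CARD('d)"])
        (auto simp: nnz_le_CARD intro!: measurable_compose[OF quantization_measurable(2)[OF quantization]])
    then show "(\<integral>\<^sup>+u. ennreal (real (nnz (Q u (batch_diff i k w)))) \<partial>U) \<le> ennreal (expected_density U Q)"
      using density_le_expected_density[OF quantization]
      by (subst nn_integral_eq_integral) (auto intro: ennreal_leI)
  qed
  finally have le: "(\<integral>\<^sup>+w. ennreal (real (nnz (message i k w))) \<partial>M) \<le> ennreal (expected_density U Q)"
    by (simp add: emeasure_space_1)
  show "integrable M (\<lambda>w. real (nnz (message i k w)))"
    and "(\<integral>w. real (nnz (message i k w)) \<partial>M) \<le> expected_density U Q"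
    using integrable_if_nn_integral_le[OF _ _ _ le] dens by auto
qed

lemma expected_communication:
  assumes i: "i \<in> {1..n}" and pd: "p * real CARD('d) \<le> expected_density U Q"
  shows "integrable M (\<lambda>w. real (communication fs m b Q c J s x K i w))"
    and "(\<integral>w. real (communication fs m b Q c J s x K i w) \<partial>M)
      \<le> real CARD('d) + 2 * expected_density U Q * real K"
proof -
  note [measurable] = rv(1) measurable_M(5)[OF i] measurable_G[OF i]
  let ?C = "\<lambda>w. real (communication fs m b Q c J s x K i w)"
  \<comment> \<open>The message is counted in every iteration, also on a \<open>True\<close> coin,
    which decouples it from the coin; a full gradient is bounded by the dimension.\<close>
  let ?B = "\<lambda>w. real CARD('d) + (\<Sum>k<K. (if c k w then real CARD('d) else 0) + real (nnz (message i k w)))"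
  have eq: "?C w = real (nnz (G i (x 0 w)))
      + (\<Sum>k<K. if c k w then real (nnz (G i (x (Suc k) w))) else real (nnz (message i k w)))" for w
    by (simp add: communication_def message_def batch_diff_def of_nat_sum if_distrib cong: if_cong)
  have le: "?C w \<le> ?B w" for w
    unfolding eq by (intro add_mono sum_mono) (auto simp: nnz_le_CARD add_increasing2)
  have intB: "integrable M ?B"
    using coin_integral(1) expected_message_density(1)[OF i] by auto
  show int: "integrable M ?C"
  proof (rule Bochner_Integration.integrable_bound[OF intB])
    show "?C \<in> borel_measurable M" unfolding eq by measurable
    show "AE w in M. norm (?C w) \<le> norm (?B w)"
      using le by (intro AE_I2) (smt (verit) of_nat_0_le_iff real_norm_def)
  qed
  have "integral\<^sup>L M ?C \<le> integral\<^sup>L M ?B"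
    using int intB le by (rule integral_mono)
  also have "\<dots> = real CARD('d) + (\<Sum>k<K. p * real CARD('d) + (\<integral>w. real (nnz (message i k w)) \<partial>M))"
    using coin_integral expected_message_density(1)[OF i]
    by (simp add: Bochner_Integration.integral_sum prob_space)
  also have "\<dots> \<le> real CARD('d) + (\<Sum>k<K. expected_density U Q + expected_density U Q)"
    using pd expected_message_density(2)[OF i] by (intro add_left_mono sum_mono add_mono)
  finally show "integral\<^sup>L M ?C \<le> real CARD('d) + 2 * expected_density U Q * real K"
    by (simp add: algebra_simps)
qed

end


section \<open>Complexity\<close>

text \<open>Rounding up at most doubles an \<open>X > 1\<close>; for smaller \<open>X\<close> one
  iteration is enough.\<close>

lemma obtain_iteration_count:
  fixes X :: real
  obtains K :: nat where "1 \<le> K" "X \<le> real K" "K = 1 \<or> real K \<le> 2 * X"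
proof (cases "X \<le> 1")
  case True
  then show ?thesis by (intro that[of 1]) auto
next
  case False
  have "real (nat \<lceil>X\<rceil>) = of_int \<lceil>X\<rceil>" using False by simp
  moreover have "X \<le> of_int \<lceil>X\<rceil>" "of_int \<lceil>X\<rceil> < X + 1" by linarith+
  ultimately show ?thesis using False by (intro that[of "nat \<lceil>X\<rceil>"]) linarith+
qed

text \<open>Subadditivity of the square root separates the contributions of \<open>L\<close> and
  \<open>\<L>\<close>. This turns the denominator of the stepsize condition into the factor of the
  complexity bounds.\<close>

lemma inverse_stepsize_le:
  fixes L \<L> \<omega> Mx n b :: real
  assumes "0 \<le> L" "0 \<le> \<L>" "0 \<le> \<omega>" "0 \<le> Mx" "0 < n" "0 < b"
  shows "L + sqrt (Mx / n * (\<omega> * L\<^sup>2 + (1 + \<omega>) * \<L>\<^sup>2 / b))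
    \<le> L * (1 + sqrt (\<omega> * Mx / n)) + \<L> * sqrt ((1 + \<omega>) * Mx / (n * b))"
proof -
  have "Mx / n * (\<omega> * L\<^sup>2 + (1 + \<omega>) * \<L>\<^sup>2 / b) = L\<^sup>2 * (\<omega> * Mx / n) + \<L>\<^sup>2 * ((1 + \<omega>) * Mx / (n * b))"
    using assms by (simp add: field_simps)
  also have "sqrt \<dots> \<le> sqrt (L\<^sup>2 * (\<omega> * Mx / n)) + sqrt (\<L>\<^sup>2 * ((1 + \<omega>) * Mx / (n * b)))"
    using assms by (intro sqrt_add_le_add_sqrt) auto
  also have "\<dots> = L * sqrt (\<omega> * Mx / n) + \<L> * sqrt ((1 + \<omega>) * Mx / (n * b))"
    using assms by (simp only: real_sqrt_mult real_sqrt_abs abs_of_nonneg)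
  finally show ?thesis by (simp add: distrib_left)
qed

text \<open>The oracle rate is \<open>b\<close> times the iteration rate. The factor moves under the
  roots as \<open>b\<^sup>2\<close>; the first maximum absorbs it, and in the second root one
  \<open>b\<close> cancels with the denominator.\<close>

lemma batch_scaled_rate:
  fixes L \<L> \<omega> a m n b :: real
  assumes "0 < n" "0 < b"
  shows "b * (L * (1 + sqrt (\<omega> * max a (m / b) / n)) + \<L> * sqrt ((1 + \<omega>) * max a (m / b) / (n * b)))
    = L * (b + sqrt (\<omega> * max (a * b\<^sup>2) (m * b) / n)) + \<L> * sqrt ((1 + \<omega>) * max (a * b) m / n)"
proof -
  have mx: "max (a * b\<^sup>2) (m * b) = b\<^sup>2 * max a (m / b)" "max (a * b) m = b * max a (m / b)"
    using assms by (simp_all add: max_mult_distrib_left power2_eq_square mult.commute)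
  have b: "b = sqrt (b\<^sup>2)" using assms by simp
  have "b * sqrt (\<omega> * max a (m / b) / n) = sqrt (b\<^sup>2 * (\<omega> * max a (m / b) / n))"
    unfolding real_sqrt_mult[of "b\<^sup>2"] using b by simp
  also have "\<dots> = sqrt (\<omega> * max (a * b\<^sup>2) (m * b) / n)"
    unfolding mx by (simp add: ac_simps)
  finally have 1: "b * sqrt (\<omega> * max a (m / b) / n) = sqrt (\<omega> * max (a * b\<^sup>2) (m * b) / n)" .
  have "b * sqrt ((1 + \<omega>) * max a (m / b) / (n * b)) = sqrt (b\<^sup>2 * ((1 + \<omega>) * max a (m / b) / (n * b)))"
    unfolding real_sqrt_mult[of "b\<^sup>2"] using b by simp
  also have "b\<^sup>2 * ((1 + \<omega>) * max a (m / b) / (n * b)) = (1 + \<omega>) * max (a * b) m / n"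
    unfolding mx using assms by (simp add: power2_eq_square)
  finally have 2: "b * sqrt ((1 + \<omega>) * max a (m / b) / (n * b)) = sqrt ((1 + \<omega>) * max (a * b) m / n)" .
  have "b * (L * (1 + u) + \<L> * v) = L * (b + b * u) + \<L> * (b * v)" for u v :: real
    by (simp add: algebra_simps)
  then show ?thesis by (simp only: 1 2)
qed

text \<open>The condition forces \<open>?r \<le> 1\<close>, so squaring \<open>?r\<close> does not
  increase it and \<open>\<gamma>\<^sup>2 * C + \<gamma> * L \<le> 1\<close> follows. Division by
  \<open>2 * \<gamma>\<close> gives the claim.\<close>

lemma stepsize_coefficient:
  fixes \<gamma> L C :: real
  assumes "0 < \<gamma>" "0 \<le> L" "0 \<le> C" "\<gamma> * (L + sqrt C) \<le> 1"
  shows "\<gamma> / 2 * C \<le> 1 / (2 * \<gamma>) - L / 2"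
proof -
  let ?r = "\<gamma> * sqrt C"
  have r: "0 \<le> ?r" "\<gamma> * L + ?r \<le> 1" "0 \<le> \<gamma> * L" using assms by (auto simp: distrib_left)
  then have "?r * ?r \<le> ?r * 1" by (intro mult_left_mono) auto
  moreover have "?r * ?r = \<gamma>\<^sup>2 * C"
    using assms(3) by (simp add: power2_eq_square algebra_simps)
  ultimately have "\<gamma>\<^sup>2 * C + \<gamma> * L \<le> 1" using r by linarith
  then show ?thesis using assms(1) by (simp add: field_simps power2_eq_square)
qed

text \<open>The map \<open>1 / p - 1\<close> is decreasing, so it turns the minimum into the maximum
  of the stepsize condition. Each entry of the minimum also controls one cost:
  \<open>\<zeta> / d\<close> that of sending full gradients, \<open>b / (m + b)\<close> that of
  computing them.\<close>

lemma min_probability: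
  fixes \<zeta> d m b :: real
  assumes "0 < \<zeta>" "\<zeta> \<le> d" "0 < b" "0 \<le> m"
  defines "p \<equiv> min (\<zeta> / d) (b / (m + b))"
  shows "0 < p" "p \<le> 1" "(1 - p) / p = max (d / \<zeta> - 1) (m / b)" "p * m \<le> b" "p * d \<le> \<zeta>"
proof -
  have d: "0 < d" using assms by linarith
  show p: "0 < p" "p \<le> 1" using assms d by (auto simp: p_def min_def)
  have "p * d \<le> \<zeta> / d * d" using d by (intro mult_right_mono) (auto simp: p_def)
  then show "p * d \<le> \<zeta>" using d by simp
  have "p * m \<le> b / (m + b) * m" using assms by (intro mult_right_mono) (auto simp: p_def)
  also have "\<dots> \<le> b" using assms by (simp add: field_simps)
  finally show "p * m \<le> b" .
  have inv: "1 / u - 1 \<le> 1 / v - 1 \<longleftrightarrow> v \<le> u" if "0 < u" "0 < v" for u v :: real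
    using that by (simp add: field_simps)
  have "(1 - p) / p = 1 / p - 1" using p by (simp add: diff_divide_distrib)
  also have "\<dots> = max (1 / (\<zeta> / d) - 1) (1 / (b / (m + b)) - 1)"
    using inv[of "\<zeta> / d" "b / (m + b)"] inv[of "b / (m + b)" "\<zeta> / d"] assms d
    unfolding p_def min_def max_def by auto
  also have "1 / (b / (m + b)) - 1 = m / b" using assms by (simp add: field_simps)
  finally show "(1 - p) / p = max (d / \<zeta> - 1) (m / b)" by simp
qed


text \<open>\<open>max 1\<close> stands in the iteration bound because a run of length 0 returns no
  point. The accuracy is claimed for all longer runs as well, the costs for \<open>K\<close> itself.
  The second alternative in \<open>stepsize_order\<close> is the case of a zero denominator, where
  every positive stepsize is admissible and there is no largest one to compare with.\<close>

theorem corollaryD1: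
  fixes fs :: "nat \<Rightarrow> nat \<Rightarrow> real ^ 'd \<Rightarrow> real"
    and Q :: "'u \<Rightarrow> real ^ 'd \<Rightarrow> real ^ 'd" and U :: "'u measure"
    and M :: "'w measure"
    and c :: "nat \<Rightarrow> 'w \<Rightarrow> bool" and J :: "nat \<Rightarrow> nat \<Rightarrow> 'w \<Rightarrow> nat set"
    and s :: "nat \<Rightarrow> nat \<Rightarrow> 'w \<Rightarrow> 'u" and \<tau> :: "nat \<Rightarrow> 'w \<Rightarrow> nat"
    and x g :: "nat \<Rightarrow> 'w \<Rightarrow> real ^ 'd" and x0 :: "real ^ 'd"
    and n m b :: nat and Ls \<L>s :: "nat \<Rightarrow> real"
    and f_low L \<L> \<Delta>0 \<omega> \<zeta> d p \<gamma> \<theta> \<epsilon> :: real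
  assumes n: "1 \<le> n" and b: "1 \<le> b" "b \<le> m"
    and differentiable: "\<And>i j y. i \<in> {1..n} \<Longrightarrow> j \<in> {1..m} \<Longrightarrow> fs i j differentiable (at y)"
    and lower_bound: "\<And>y. f_low \<le> global_loss fs n m y"
    and smooth: "\<And>i. i \<in> {1..n} \<Longrightarrow>
                   (Ls i)-lipschitz_on UNIV (gradient (local_loss fs m i))"
    and L: "L = sqrt ((\<Sum>i=1..n. (Ls i)\<^sup>2) / real n)"
    and \<L>: "\<L> = sqrt ((\<Sum>i=1..n. (\<L>s i)\<^sup>2) / real n)"
    and \<Delta>0: "\<Delta>0 = global_loss fs n m x0 - f_low"
    and quantization: "quantization U Q \<omega>"
    and \<zeta>: "\<zeta> = expected_density U Q"
    and d: "d = real CARD('d)"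
    and p: "p = min (\<zeta> / d) (real b / real (m + b))"
    and sampling: "sampling M U n m b p c J s \<tau>"
    and vr_marina: "vr_marina M fs n m b Q \<gamma> x0 c J s x g"
    and average_smooth: "average_smooth M fs n m b J x \<L>s"
    and stepsize: "0 < \<gamma>"
      "\<gamma> * (L + sqrt (max (d / \<zeta> - 1) (real m / real b) / real n
                       * (\<omega> * L\<^sup>2 + (1 + \<omega>) * \<L>\<^sup>2 / real b))) \<le> 1"
    and stepsize_order: "0 < \<theta>" "\<theta> \<le> 1"
      "\<theta> \<le> \<gamma> * (L + sqrt (max (d / \<zeta> - 1) (real m / real b) / real n
                       * (\<omega> * L\<^sup>2 + (1 + \<omega>) * \<L>\<^sup>2 / real b)))
       \<or> L + sqrt (max (d / \<zeta> - 1) (real m / real b) / real n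
                       * (\<omega> * L\<^sup>2 + (1 + \<omega>) * \<L>\<^sup>2 / real b)) = 0"
    and \<epsilon>: "0 < \<epsilon>"
  shows "\<exists>K\<ge>1.
    real K \<le> max 1 (O_const \<theta> *
      (\<Delta>0 / \<epsilon>\<^sup>2 *
        (L * (1 + sqrt (\<omega> * max (d / \<zeta> - 1) (real m / real b) / real n))
         + \<L> * sqrt ((1 + \<omega>) * max (d / \<zeta> - 1) (real m / real b) / (real n * real b))))) \<and>
    (\<forall>K'\<ge>K. integrable M (\<lambda>w. (norm (gradient (global_loss fs n m) (x (\<tau> K' w) w)))\<^sup>2) \<and>
       (\<integral>w. (norm (gradient (global_loss fs n m) (x (\<tau> K' w) w)))\<^sup>2 \<partial>M) \<le> \<epsilon>\<^sup>2) \<and>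
    (\<forall>i\<in>{1..n}. integrable M (\<lambda>w. real (oracle_calls m c J K i w)) \<and>
       (\<integral>w. real (oracle_calls m c J K i w) \<partial>M) \<le> O_const \<theta> *
         (real m + \<Delta>0 / \<epsilon>\<^sup>2 *
           (L * (real b + sqrt (\<omega> * max ((d / \<zeta> - 1) * (real b)\<^sup>2) (real m * real b) / real n))
            + \<L> * sqrt ((1 + \<omega>) * max ((d / \<zeta> - 1) * real b) (real m) / real n)))) \<and>
    (\<forall>i\<in>{1..n}. integrable M (\<lambda>w. real (communication fs m b Q c J s x K i w)) \<and>
       (\<integral>w. real (communication fs m b Q c J s x K i w) \<partial>M) \<le> O_const \<theta> *
         (d + \<Delta>0 * \<zeta> / \<epsilon>\<^sup>2 *
           (L * (1 + sqrt (\<omega> * max (d / \<zeta> - 1) (real m / real b) / real n))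
            + \<L> * sqrt ((1 + \<omega>) * max (d / \<zeta> - 1) (real m / real b) / (real n * real b)))))"
proof -
  \<comment> \<open>\<open>Mx\<close> equals \<open>(1 - p) / p\<close>, \<open>T\<close> is the
    reciprocal of the largest admissible stepsize unless it is zero, and \<open>R\<close> is the
    factor in the iteration and communication bounds.\<close>
  define Mx where "Mx = max (d / \<zeta> - 1) (real m / real b)"
  define T where "T = L + sqrt (Mx / real n * (\<omega> * L\<^sup>2 + (1 + \<omega>) * \<L>\<^sup>2 / real b))"
  define R where "R = L * (1 + sqrt (\<omega> * Mx / real n)) + \<L> * sqrt ((1 + \<omega>) * Mx / (real n * real b))"
  have n0: "0 < real n" and b0: "0 < real b" and m0: "real b \<le> real m" using n b by auto
  have \<omega>: "0 < \<omega>" using quantization by (simp add: quantization_def)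
  have \<zeta>d: "0 < \<zeta>" "\<zeta> \<le> d"
    unfolding \<zeta> d using expected_density_pos[OF quantization] expected_density_le[OF quantization] .
  have pp: "0 < p" "p \<le> 1" "(1 - p) / p = Mx" "p * real m \<le> real b" "p * d \<le> \<zeta>"
    using min_probability[of \<zeta> d "real b" "real m"] \<zeta>d b0 unfolding Mx_def p by auto
  have L0: "0 \<le> L" "0 \<le> \<L>" unfolding L \<L> by (auto intro!: divide_nonneg_nonneg sum_nonneg)
  have Mx0: "0 \<le> Mx" unfolding Mx_def by (simp add: le_max_iff_disj)
  have T0: "0 \<le> T"
    unfolding T_def using L0 \<omega> Mx0 by (auto intro!: add_nonneg_nonneg)
  have TR: "T \<le> R"
    unfolding T_def R_def using L0 \<omega> Mx0 n0 b0 by (intro inverse_stepsize_le) auto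
  have \<Delta>0_nonneg: "0 \<le> \<Delta>0" using lower_bound[of x0] \<Delta>0 by simp
  interpret vr_marina_run fs Q U M c J s \<tau> x g x0 n m b Ls \<L>s \<omega> p \<gamma>
    by unfold_locales
      (use n b differentiable smooth quantization pp sampling vr_marina average_smooth stepsize(1) in auto)
  have lip: "norm (gradient f y - gradient f z) \<le> L * norm (y - z)" for y z
    unfolding L by (rule gradient_f_lipschitz)
  have "L\<^sup>2 = (\<Sum>i=1..n. (Ls i)\<^sup>2) / real n" "\<L>\<^sup>2 = (\<Sum>i=1..n. (\<L>s i)\<^sup>2) / real n"
    unfolding L \<L> by (auto intro!: real_sqrt_pow2 divide_nonneg_nonneg sum_nonneg)
  then have sums: "(\<Sum>i=1..n. (Ls i)\<^sup>2) = real n * L\<^sup>2" "(\<Sum>i=1..n. (\<L>s i)\<^sup>2) = real n * \<L>\<^sup>2"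
    using n0 by simp_all
  have "(\<Sum>i=1..n. \<omega> * (Ls i)\<^sup>2 + (1 + \<omega>) * (\<L>s i)\<^sup>2 / real b)
      = \<omega> * (\<Sum>i=1..n. (Ls i)\<^sup>2) + (1 + \<omega>) * (\<Sum>i=1..n. (\<L>s i)\<^sup>2) / real b"
    by (simp only: sum.distrib sum_distrib_left sum_divide_distrib)
  also have "\<dots> = real n * (\<omega> * L\<^sup>2 + (1 + \<omega>) * \<L>\<^sup>2 / real b)"
    unfolding sums by (simp add: algebra_simps)
  finally have var: "variance_const = (\<omega> * L\<^sup>2 + (1 + \<omega>) * \<L>\<^sup>2 / real b) / real n"
    unfolding variance_const_def using n0 by (simp add: power2_eq_square)
  let ?N = "\<lambda>K. \<integral>w. (norm (gradient f (x (\<tau> K w) w)))\<^sup>2 \<partial>M"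
  have rate: "?N K \<le> 2 * \<Delta>0 / \<gamma> / real K" if K: "1 \<le> K" for K
  proof -
    have "\<gamma> / 2 * ((1 - p) / p * variance_const) \<le> 1 / (2 * \<gamma>) - L / 2"
    proof (rule stepsize_coefficient[OF \<gamma> L0(1)])
      show "0 \<le> (1 - p) / p * variance_const"
        unfolding var pp(3) using Mx0 \<omega> n0 b0 by simp
      have "(1 - p) / p * variance_const = Mx / real n * (\<omega> * L\<^sup>2 + (1 + \<omega>) * \<L>\<^sup>2 / real b)"
        unfolding var pp(3) by simp
      then show "\<gamma> * (L + sqrt ((1 - p) / p * variance_const)) \<le> 1"
        using stepsize(2) unfolding Mx_def by (simp only:)
    qed
    from sum_gradient_norm_le[OF lower_bound lip pp(1) this, of K]
    have "(\<Sum>k<K. \<integral>w. (norm (gradient f (x k w)))\<^sup>2 \<partial>M) \<le> 2 * \<Delta>0 / \<gamma>"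
      using \<gamma> unfolding \<Delta>0 by (simp add: field_simps)
    then show ?thesis
      unfolding output_gradient_norm(2)[OF K] using K by (intro divide_right_mono) auto
  qed
  \<comment> \<open>Twice the count \<open>2 * \<Delta>0 / (\<gamma> * \<epsilon>\<^sup>2)\<close>
    demanded by \<open>rate\<close>, with \<open>1 / \<gamma>\<close> replaced by its bound
    \<open>R / \<theta>\<close>; the factor two pays for rounding up.\<close>
  define Y where "Y = 4 * \<Delta>0 / (\<theta> * \<epsilon>\<^sup>2) * R"
  have Y0: "0 \<le> Y" unfolding Y_def using \<Delta>0_nonneg stepsize_order(1) T0 TR by simp
  obtain K where K: "1 \<le> K" "\<And>K'. K \<le> K' \<Longrightarrow> ?N K' \<le> \<epsilon>\<^sup>2" "real K \<le> max 1 Y"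
  proof (cases "T = 0")
    \<comment> \<open>A zero denominator forces \<open>L = 0\<close>; then the gradient vanishes
      everywhere and a single iteration suffices.\<close>
    case True
    have "0 \<le> sqrt (Mx / real n * (\<omega> * L\<^sup>2 + (1 + \<omega>) * \<L>\<^sup>2 / real b))"
      using Mx0 \<omega> n0 b0 by simp
    then have "L = 0" using True L0 unfolding T_def by linarith
    then have "gradient f y = 0" for y
      using lip by (intro gradient_eq_0_of_bounded_below[OF differentiable_f _ lower_bound]) simp
    then show thesis using \<epsilon> by (intro that[of 1]) simp_all
  next
    case False
    then have \<theta>T: "\<theta> \<le> \<gamma> * T"
      using stepsize_order(3) unfolding T_def Mx_def by blast
    have "1 / \<gamma> \<le> R / \<theta>"
    proof -
      have "\<theta> \<le> \<gamma> * R" using \<theta>T mult_left_mono[OF TR, of \<gamma>] \<gamma> by linarith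
      then show ?thesis using \<gamma> stepsize_order(1) by (simp add: field_simps)
    qed
    then have "4 * \<Delta>0 / \<epsilon>\<^sup>2 * (1 / \<gamma>) \<le> 4 * \<Delta>0 / \<epsilon>\<^sup>2 * (R / \<theta>)"
      using \<Delta>0_nonneg by (intro mult_left_mono) auto
    then have XY: "2 * (2 * \<Delta>0 / \<gamma> / \<epsilon>\<^sup>2) \<le> Y"
      unfolding Y_def by (simp add: mult.commute)
    obtain K where K: "1 \<le> K" "2 * \<Delta>0 / \<gamma> / \<epsilon>\<^sup>2 \<le> real K"
      "K = 1 \<or> real K \<le> 2 * (2 * \<Delta>0 / \<gamma> / \<epsilon>\<^sup>2)"
      by (rule obtain_iteration_count)
    have swap: "A / u \<le> v \<Longrightarrow> 0 < u \<Longrightarrow> 0 < v \<Longrightarrow> A / v \<le> u" for A u v :: real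
      by (simp add: pos_divide_le_eq mult.commute)
    show thesis
    proof (rule that[OF K(1)])
      fix K' assume "K \<le> K'"
      then have "2 * \<Delta>0 / \<gamma> / \<epsilon>\<^sup>2 \<le> real K'" and K': "1 \<le> K'" using K(1,2) by linarith+
      then have "2 * \<Delta>0 / \<gamma> / real K' \<le> \<epsilon>\<^sup>2" 
        using swap[of "2 * \<Delta>0 / \<gamma>" "\<epsilon>\<^sup>2" "real K'"] \<epsilon> by simp
      then show "?N K' \<le> \<epsilon>\<^sup>2" using rate[OF K'] by linarith
    qed (use K(3) XY in auto)
  qed
  \<comment> \<open>12 is the product of the 3 oracle calls per minibatch element and iteration with
    the 4 in \<open>Y\<close>; dividing it by \<theta> does not decrease it, as
    \<open>\<theta> \<le> 1\<close>.\<close>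
  have O: "12 * u \<le> O_const \<theta> * u" if "0 \<le> u" for u
    using that stepsize_order(1,2) by (auto simp: O_const_def field_simps mult_left_le_one_le)
  have KY: "real K \<le> 1 + Y" using K(3) Y0 by linarith
  have 1: "real K \<le> max 1 (O_const \<theta> * (\<Delta>0 / \<epsilon>\<^sup>2 * R))"
  proof -
    have "Y \<le> O_const \<theta> * (\<Delta>0 / \<epsilon>\<^sup>2 * R)"
    proof -
      define z where "z = \<Delta>0 * R / (\<theta> * \<epsilon>\<^sup>2)"
      have "Y = 4 * z" "O_const \<theta> * (\<Delta>0 / \<epsilon>\<^sup>2 * R) = 12 * z"
        by (simp_all add: Y_def O_const_def z_def)
      moreover have "0 \<le> z" using \<Delta>0_nonneg T0 TR stepsize_order(1) by (simp add: z_def)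
      ultimately show ?thesis by simp
    qed
    then show ?thesis using K(3) by linarith
  qed
  have 2: "real m + 3 * real b * real K \<le> O_const \<theta> * (real m + \<Delta>0 / \<epsilon>\<^sup>2 * (real b * R))"
  proof -
    have "real m + 3 * real b * real K \<le> real m + 3 * real b * (1 + Y)"
      using KY by (intro add_left_mono mult_left_mono) auto
    \<comment> \<open>By \<open>b \<le> m\<close>, the calls of the one additional iteration are
      charged to the initial full gradient.\<close>
    also have "\<dots> \<le> 4 * real m + 3 * real b * Y" using m0 by (simp add: distrib_left)
    also have "\<dots> \<le> O_const \<theta> * real m + O_const \<theta> * (\<Delta>0 / \<epsilon>\<^sup>2 * (real b * R))"
    proof (rule add_mono)
      show "4 * real m \<le> O_const \<theta> * real m"
        using O[of "real m"] by simp
      show "3 * real b * Y \<le> O_const \<theta> * (\<Delta>0 / \<epsilon>\<^sup>2 * (real b * R))"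
        unfolding Y_def O_const_def by (simp add: ac_simps)
    qed
    finally show ?thesis by (simp add: distrib_left)
  qed
  have 3: "d + 2 * \<zeta> * real K \<le> O_const \<theta> * (d + \<Delta>0 * \<zeta> / \<epsilon>\<^sup>2 * R)"
  proof -
    have "d + 2 * \<zeta> * real K \<le> d + 2 * \<zeta> * (1 + Y)"
      using KY \<zeta>d by (intro add_left_mono mult_left_mono) auto
    \<comment> \<open>The factor 2 is relaxed to 3 so that, with the 4 in \<open>Y\<close>, the
      common constant 12 results.\<close>
    also have "\<dots> \<le> 12 * d + 3 * \<zeta> * Y"
    proof -
      have "2 * \<zeta> * (1 + Y) = 2 * \<zeta> + 2 * (\<zeta> * Y)" "0 \<le> \<zeta> * Y" "3 * \<zeta> * Y = 3 * (\<zeta> * Y)"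
        using \<zeta>d Y0 by (simp_all add: algebra_simps)
      then show ?thesis using \<zeta>d by linarith
    qed
    also have "\<dots> \<le> O_const \<theta> * d + O_const \<theta> * (\<Delta>0 * \<zeta> / \<epsilon>\<^sup>2 * R)"
    proof (rule add_mono)
      show "12 * d \<le> O_const \<theta> * d"
        using O[of d] \<zeta>d by simp
      show "3 * \<zeta> * Y \<le> O_const \<theta> * (\<Delta>0 * \<zeta> / \<epsilon>\<^sup>2 * R)"
        unfolding Y_def O_const_def by (simp add: ac_simps)
    qed
    finally show ?thesis by (simp add: distrib_left)
  qed
  show ?thesis
  proof (intro exI[of _ K] conjI ballI allI impI)
    show "1 \<le> K" by (rule K)
    show "real K \<le> max 1 (O_const \<theta> *
      (\<Delta>0 / \<epsilon>\<^sup>2 *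
        (L * (1 + sqrt (\<omega> * max (d / \<zeta> - 1) (real m / real b) / real n))
         + \<L> * sqrt ((1 + \<omega>) * max (d / \<zeta> - 1) (real m / real b) / (real n * real b)))))"
      using 1 unfolding R_def Mx_def .
    fix K' assume "K \<le> K'"
    then show "integrable M (\<lambda>w. (norm (gradient f (x (\<tau> K' w) w)))\<^sup>2)" "?N K' \<le> \<epsilon>\<^sup>2"
      using K(1,2) by (auto intro: output_gradient_norm(1))
  next
    fix i assume i: "i \<in> {1..n}"
    show "integrable M (\<lambda>w. real (oracle_calls m c J K i w))"
      using expected_oracle_calls(1)[OF i pp(4)] .
    show "(\<integral>w. real (oracle_calls m c J K i w) \<partial>M) \<le> O_const \<theta> *
         (real m + \<Delta>0 / \<epsilon>\<^sup>2 *
           (L * (real b + sqrt (\<omega> * max ((d / \<zeta> - 1) * (real b)\<^sup>2) (real m * real b) / real n))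
            + \<L> * sqrt ((1 + \<omega>) * max ((d / \<zeta> - 1) * real b) (real m) / real n)))"
      using order_trans[OF expected_oracle_calls(2)[OF i pp(4)] 2]
      unfolding R_def Mx_def batch_scaled_rate[OF n0 b0] .
    show "integrable M (\<lambda>w. real (communication fs m b Q c J s x K i w))"
      using expected_communication(1)[OF i] pp(5) unfolding \<zeta> d .
    show "(\<integral>w. real (communication fs m b Q c J s x K i w) \<partial>M) \<le> O_const \<theta> *
         (d + \<Delta>0 * \<zeta> / \<epsilon>\<^sup>2 *
           (L * (1 + sqrt (\<omega> * max (d / \<zeta> - 1) (real m / real b) / real n))
            + \<L> * sqrt ((1 + \<omega>) * max (d / \<zeta> - 1) (real m / real b) / (real n * real b))))"
      using order_trans[OF _ 3, OF expected_communication(2)[OF i, folded \<zeta> d, OF pp(5)]]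
      unfolding R_def Mx_def .
  qed
qed

end
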